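(* Let $N=\{1,\ldots,n\}$ and let $C \subset \mathbb{Z}^n$ be a bounded integral hole-free set. The following statements are equivalent: (1) $C$ has a least weakly absolutely $(1,b)$-majorized element for each $b \in \mathbb{Z}^n$; (2) for each $b \in \mathbb{Z}^n$, there exists $x^* \in C$ that is an optimal solution to $\min_{x \in C} \Phi(x+b)$ for any choice of monotonically even continuous Schur-convex function $\Phi:\mathbb{R}^n\to\mathbb{R}$; (3) for each permutation $\pi$ of $N$ and sign vector $s \in \{-1,1\}^n$ there exists $x^* \in C$ such that for all $x \in C$ we have $\sum_{i=1}^k s_{\pi(i)} x^*_{\pi(i)} \geq \sum_{i=1}^k s_{\pi(i)} x_{\pi(i)}$ for all $k \in N$; (4) the function $h(X,Y) := \max_{x \in C} (x(X) - x(Y))$, $(X,Y)\in 3^N$, is integral and bisubmodular and $C = \tilde{B}^{\mathbb{Z}}(h)$.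
   Context: Notation: $x(A) := \sum_{i\in A} x_i$ for $x\in\mathbb{R}^n$, $A\subseteq N$; in "$(1,b)$", $1$ is the all-ones vector. $3^N$ is the set of ordered pairs $(S,T)$ of disjoint subsets of $N$. "Integral" means integer-valued. A set $C\subseteq\mathbb{Z}^n$ is hole-free if $C=\mathrm{co}(C)\cap\mathbb{Z}^n$, where $\mathrm{co}$ denotes convex hull. Weak absolute $(1,b)$-majorization: $x$ is weakly absolutely $(1,b)$-majorized by $y$ if $\sum_{i\in N}\phi(x_i+b_i)\le \sum_{i\in N}\phi(y_i+b_i)$ for all even continuous convex functions $\phi:\mathbb{R}\to\mathbb{R}$. A vector $x\in C$ is a least weakly absolutely $(1,b)$-majorized element of $C$ if $x$ is weakly absolutely $(1,b)$-majorized by every $y\in C$. Schur-convexity: let $x^{\downarrow}$ denote the rearrangement of $x$ in non-increasing order; $x\prec y$ if $\sum_{i=1}^k x^{\downarrow}_i\le\sum_{i=1}^k y^{\downarrow}_i$ for all $k\in N$ and $x(N)=y(N)$. $\Phi:\mathbb{R}^n\to\mathbb{R}$ is Schur-convex if $x\prec y$ implies $\Phi(x)\le\Phi(y)$. A Schur-convex function $\Phi$ is monotonically even if for every $i\in N$ and $x\in\mathbb{R}^n$: $\Phi$ is unchanged when $x_i$ is replaced by $-x_i$; if $x_i\le 0$ and $\epsilon>0$, replacing $x_i$ by $x_i-\epsilon$ does not decrease $\Phi$; and if $x_i\ge0$ and $\epsilon>0$, replacing $x_i$ by $x_i+\epsilon$ does not decrease $\Phi$. Bisubmodularity: $h:3^N\to\mathbb{R}$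 with $h(\emptyset,\emptyset)=0$ is bisubmodular if for all $(S_1,T_1),(S_2,T_2)\in 3^N$, $h(S_1,T_1)+h(S_2,T_2)\ge h\big((S_1\cup S_2)\setminus(T_1\cup T_2),(T_1\cup T_2)\setminus(S_1\cup S_2)\big)+h(S_1\cap S_2,T_1\cap T_2)$. The integral bisubmodular polyhedron defined by $h$ is $\tilde B^{\mathbb{Z}}(h):=\{x\in\mathbb{Z}^n: x(S)-x(T)\le h(S,T)\ \forall (S,T)\in 3^N\}$. *)

theory Defs
  imports "HOL-Analysis.Analysis" "HOL-Library.Multiset"
begin

text \<open>The ground set \<open>N\<close> is the universe of the finite index type \<open>'n\<close>, so that \<open>n = CARD('n)\<close>.\<close>

definition int_vectors :: "(real ^ 'n) set" where
  "int_vectors = {x. \<forall>i. x $ i \<in> \<int>}"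

definition hole_free :: "(real ^ 'n) set \<Rightarrow> bool" where
  "hole_free C \<longleftrightarrow> C = convex hull C \<inter> int_vectors"

definition vsum :: "real ^ 'n \<Rightarrow> 'n set \<Rightarrow> real" where
  "vsum x A = (\<Sum>i\<in>A. x $ i)"

definition disjoint_pairs :: "('n set \<times> 'n set) set" where
  "disjoint_pairs = {(S, T). S \<inter> T = {}}"

definition weakly_abs_majorized :: "real ^ 'n \<Rightarrow> real ^ 'n \<Rightarrow> real ^ 'n \<Rightarrow> bool" where
  "weakly_abs_majorized b x y \<longleftrightarrow>
     (\<forall>\<phi> :: real \<Rightarrow> real.
        (\<forall>t. \<phi> (- t) = \<phi> t) \<and> continuous_on UNIV \<phi> \<and> convex_on UNIV \<phi> \<longrightarrow>
        (\<Sum>i\<in>UNIV. \<phi> (x $ i + b $ i)) \<le> (\<Sum>i\<in>UNIV. \<phi> (y $ i + b $ i)))"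

definition least_weakly_abs_majorized ::
    "real ^ 'n \<Rightarrow> (real ^ 'n) set \<Rightarrow> real ^ 'n \<Rightarrow> bool" where
  "least_weakly_abs_majorized b C x \<longleftrightarrow>
     x \<in> C \<and> (\<forall>y\<in>C. weakly_abs_majorized b x y)"

text \<open>The entries of \<open>x\<close>, with multiplicity, in non-increasing order. List positions start
  at \<open>0\<close>, so the sum of the \<open>k\<close> largest entries is the sum over positions below \<open>k\<close>.\<close>

definition decreasing_rearrangement :: "real ^ 'n \<Rightarrow> real list" where
  "decreasing_rearrangement x =
     rev (sorted_list_of_multiset (image_mset (\<lambda>i. x $ i) (mset_set UNIV)))"

definition majorized :: "real ^ 'n \<Rightarrow> real ^ 'n \<Rightarrow> bool" where
  "majorized x y \<longleftrightarrow>
     (\<forall>k\<in>{1..CARD('n)}. (\<Sum>i<k. decreasing_rearrangement x ! i)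
                       \<le> (\<Sum>i<k. decreasing_rearrangement y ! i)) \<and>
     vsum x UNIV = vsum y UNIV"

definition schur_convex :: "(real ^ 'n \<Rightarrow> real) \<Rightarrow> bool" where
  "schur_convex \<Phi> \<longleftrightarrow> (\<forall>x y. majorized x y \<longrightarrow> \<Phi> x \<le> \<Phi> y)"

definition replace_entry :: "real ^ 'n \<Rightarrow> 'n \<Rightarrow> real \<Rightarrow> real ^ 'n" where
  "replace_entry x i c = (\<chi> j. if j = i then c else x $ j)"

definition monotonically_even :: "(real ^ 'n \<Rightarrow> real) \<Rightarrow> bool" where
  "monotonically_even \<Phi> \<longleftrightarrow>
     (\<forall>i x. \<Phi> (replace_entry x i (- (x $ i))) = \<Phi> x \<and>
        (\<forall>\<epsilon>>0. x $ i \<le> 0 \<longrightarrow> \<Phi> x \<le> \<Phi> (replace_entry x i (x $ i - \<epsilon>))) \<and>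
        (\<forall>\<epsilon>>0. x $ i \<ge> 0 \<longrightarrow> \<Phi> x \<le> \<Phi> (replace_entry x i (x $ i + \<epsilon>))))"

text \<open>Set functions on \<open>3\<^sup>N\<close> are total functions of two sets; only their values on
  \<^const>\<open>disjoint_pairs\<close> are ever used.\<close>

definition integral_on_pairs :: "('n set \<Rightarrow> 'n set \<Rightarrow> real) \<Rightarrow> bool" where
  "integral_on_pairs h \<longleftrightarrow> (\<forall>(S, T)\<in>disjoint_pairs. h S T \<in> \<int>)"

definition bisubmodular :: "('n set \<Rightarrow> 'n set \<Rightarrow> real) \<Rightarrow> bool" where
  "bisubmodular h \<longleftrightarrow> h {} {} = 0 \<and>
     (\<forall>(S1, T1)\<in>disjoint_pairs. \<forall>(S2, T2)\<in>disjoint_pairs.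
        h S1 T1 + h S2 T2 \<ge>
          h ((S1 \<union> S2) - (T1 \<union> T2)) ((T1 \<union> T2) - (S1 \<union> S2)) + h (S1 \<inter> S2) (T1 \<inter> T2))"

definition int_bisubmodular_polyhedron ::
    "('n set \<Rightarrow> 'n set \<Rightarrow> real) \<Rightarrow> (real ^ 'n) set" where
  "int_bisubmodular_polyhedron h =
     {x \<in> int_vectors. \<forall>(S, T)\<in>disjoint_pairs. vsum x S - vsum x T \<le> h S T}"

text \<open>The maximum is attained when \<open>C\<close> is a nonempty bounded set of integer vectors, as \<open>C\<close> is
  then finite. If \<open>C\<close> is empty, this is an unspecified constant \<open>c\<close>, which is never a
  bisubmodular function defining \<open>C\<close>: this would require \<open>c = 0\<close>, but then the polyhedron
  contains the zero vector.\<close>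

definition support_fun :: "(real ^ 'n) set \<Rightarrow> 'n set \<Rightarrow> 'n set \<Rightarrow> real" where
  "support_fun C X Y = Max ((\<lambda>x. vsum x X - vsum x Y) ` C)"

end

theory Submission imports Defs begin

text \<open>
  A pair \<open>(S, T)\<close> of disjoint sets is encoded as the vector with entries \<open>1\<close> on \<open>S\<close>, \<open>- 1\<close> on \<open>T\<close> and
  \<open>0\<close> elsewhere, so that \<open>x(S) - x(T)\<close> becomes an inner product; the two pairs on the
  right-hand side of bisubmodularity then add up to the two pairs on the left.

  (1) \<open>\<Longrightarrow>\<close> (3) and (2) \<open>\<Longrightarrow>\<close> (3): for a suitably spread out shift \<open>b\<close>, the hinges \<open>max (\<bar>t\<bar> - c) 0\<close> select exactly the
  signed prefix sums. (3) \<open>\<Longrightarrow>\<close> (4): by Abel summation the prefix optimum maximises every linear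
  functional that is comonotone with the given order and signs. This yields bisubmodularity, as
  join and meet are both comonotone with their sum, and, by separation from the convex hull,
  that \<open>C\<close> is the whole polyhedron. (4) \<open>\<Longrightarrow>\<close> (3) is the greedy algorithm.

  (4) \<open>\<Longrightarrow>\<close> (1) and (4) \<open>\<Longrightarrow>\<close> (2): let \<open>x\<close> minimise \<open>\<bar>x + b\<bar>\<^sup>2\<close> over \<open>C\<close>. An exchange argument produces, for each integer
  level \<open>c \<ge> 0\<close>, a tight constraint which certifies that \<open>x\<close> also minimises the sum of the hinges
  at level \<open>c\<close>. On the integers every even convex function is a constant plus a nonnegative
  combination of these hinges, which gives (1); the hinge sums also control the sums of the
  \<open>k\<close> largest absolute values, which gives (2).
\<close>

subsection \<open>Sign vectors\<close>

definition sign_vectors :: "(real ^ 'n) set" where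
  "sign_vectors = {f. \<forall>i. f $ i \<in> {- 1, 0, 1}}"

text \<open>Opposite entries cancel to 0. This matches the first pair on the right-hand side of
  bisubmodularity, from which the elements lying in both unions are removed.\<close>

definition sign_join :: "real ^ 'n \<Rightarrow> real ^ 'n \<Rightarrow> real ^ 'n" where
  "sign_join f g = (\<chi> i. sgn (f $ i + g $ i))"

definition sign_meet :: "real ^ 'n \<Rightarrow> real ^ 'n \<Rightarrow> real ^ 'n" where
  "sign_meet f g = (\<chi> i. if f $ i = g $ i then f $ i else 0)"

definition sign_bisubmodular :: "(real ^ 'n \<Rightarrow> real) \<Rightarrow> bool" where
  "sign_bisubmodular H \<longleftrightarrow> H 0 = 0 \<and>
     (\<forall>f\<in>sign_vectors. \<forall>g\<in>sign_vectors. H (sign_join f g) + H (sign_meet f g) \<le> H f + H g)"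

definition sign_fun :: "('n set \<Rightarrow> 'n set \<Rightarrow> real) \<Rightarrow> real ^ 'n \<Rightarrow> real" where
  "sign_fun h f = h {i. f $ i = 1} {i. f $ i = - 1}"

definition sign_polyhedron :: "(real ^ 'n \<Rightarrow> real) \<Rightarrow> (real ^ 'n) set" where
  "sign_polyhedron H = {x \<in> int_vectors. \<forall>f\<in>sign_vectors. f \<bullet> x \<le> H f}"

lemma sign_vectorsD: "f \<in> sign_vectors \<Longrightarrow> f $ i = - 1 \<or> f $ i = 0 \<or> f $ i = 1"
  by (auto simp: sign_vectors_def)

lemma sign_vectors_join_meet [simp]:
  "f \<in> sign_vectors \<Longrightarrow> g \<in> sign_vectors \<Longrightarrow> sign_join f g \<in> sign_vectors"
  "f \<in> sign_vectors \<Longrightarrow> g \<in> sign_vectors \<Longrightarrow> sign_meet f g \<in> sign_vectors"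
  "0 \<in> sign_vectors"
  by (auto simp: sign_vectors_def sign_join_def sign_meet_def sgn_if)

lemma sign_join_plus_meet:
  assumes "f \<in> sign_vectors" "g \<in> sign_vectors"
  shows "sign_join f g + sign_meet f g = f + g"
proof (simp only: vec_eq_iff, rule allI)
  fix i
  show "(sign_join f g + sign_meet f g) $ i = (f + g) $ i"
    using sign_vectorsD[OF assms(1), of i] sign_vectorsD[OF assms(2), of i]
    by (auto simp: sign_join_def sign_meet_def)
qed

lemma inner_join_meet:
  assumes "f \<in> sign_vectors" "g \<in> sign_vectors"
  shows "sign_join f g \<bullet> x + sign_meet f g \<bullet> x = f \<bullet> x + g \<bullet> x"
  by (metis assms inner_add_left sign_join_plus_meet)

text \<open>Every disjoint pair is the pair of level sets at 1 and -1 of some sign vector. Hence any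
  condition quantified over \<open>disjoint_pairs\<close> can be transferred to sign vectors in one
  rewrite.\<close>

lemma ball_disjoint_pairs_iff:
  fixes P :: "'n::finite set \<Rightarrow> 'n set \<Rightarrow> bool"
  shows "(\<forall>(S, T)\<in>disjoint_pairs. P S T) \<longleftrightarrow>
    (\<forall>f\<in>sign_vectors. P {i. f $ i = 1} {i. f $ i = - 1})"
proof
  assume "\<forall>(S, T)\<in>disjoint_pairs. P S T"
  moreover have "({i. f $ i = 1}, {i. f $ i = - 1}) \<in> disjoint_pairs" for f :: "real ^ 'n"
    by (auto simp: disjoint_pairs_def)
  ultimately show "\<forall>f\<in>sign_vectors. P {i. f $ i = 1} {i. f $ i = - 1}"
    by blast
next
  assume *: "\<forall>f\<in>sign_vectors. P {i. f $ i = 1} {i. f $ i = - 1}"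
  show "\<forall>(S, T)\<in>disjoint_pairs. P S T"
  proof clarify
    fix S T :: "'n set"
    assume ST: "(S, T) \<in> disjoint_pairs"
    define f :: "real ^ 'n" where "f = (\<chi> i. if i \<in> S then 1 else if i \<in> T then - 1 else 0)"
    have "f \<in> sign_vectors" by (auto simp: f_def sign_vectors_def)
    moreover have "{i. f $ i = 1} = S" by (auto simp: f_def split: if_splits)
    moreover have "{i. f $ i = - 1} = T"
      using ST by (auto simp: f_def disjoint_pairs_def split: if_splits)
    ultimately show "P S T" using * by auto
  qed
qed

lemma vsum_diff_eq_inner:
  assumes "f \<in> sign_vectors"
  shows "vsum x {i. f $ i = 1} - vsum x {i. f $ i = - 1} = f \<bullet> x"
proof -
  have "f \<bullet> x = (\<Sum>i\<in>UNIV. (if f $ i = 1 then x $ i else 0) - (if f $ i = - 1 then x $ i else 0))"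
    unfolding inner_vec_def
  proof (rule sum.cong)
    fix i
    show "f $ i \<bullet> x $ i = (if f $ i = 1 then x $ i else 0) - (if f $ i = - 1 then x $ i else 0)"
      using sign_vectorsD[OF assms, of i] by auto
  qed simp
  then show ?thesis
    by (simp add: vsum_def sum_subtractf sum.If_cases)
qed

lemma integral_on_pairs_iff: "integral_on_pairs h \<longleftrightarrow> (\<forall>f\<in>sign_vectors. sign_fun h f \<in> \<int>)"
  unfolding integral_on_pairs_def sign_fun_def by (rule ball_disjoint_pairs_iff)

lemma int_bisubmodular_polyhedron_eq: "int_bisubmodular_polyhedron h = sign_polyhedron (sign_fun h)"
  unfolding int_bisubmodular_polyhedron_def sign_polyhedron_def sign_fun_def
  by (simp add: ball_disjoint_pairs_iff vsum_diff_eq_inner)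

lemma bisubmodular_iff: "bisubmodular h \<longleftrightarrow> sign_bisubmodular (sign_fun h)"
proof -
  have join_pos: "{i. f $ i = 1} \<union> {i. g $ i = 1} - ({i. f $ i = - 1} \<union> {i. g $ i = - 1})
      = {i. sign_join f g $ i = 1}"
    and join_neg: "{i. f $ i = - 1} \<union> {i. g $ i = - 1} - ({i. f $ i = 1} \<union> {i. g $ i = 1})
      = {i. sign_join f g $ i = - 1}"
    and meet_pos: "{i. f $ i = 1} \<inter> {i. g $ i = 1} = {i. sign_meet f g $ i = 1}"
    and meet_neg: "{i. f $ i = - 1} \<inter> {i. g $ i = - 1} = {i. sign_meet f g $ i = - 1}"
    if fg: "f \<in> sign_vectors" "g \<in> sign_vectors" for f g :: "real ^ 'b"
  proof -
    have *: "(f $ i = - 1 \<or> f $ i = 0 \<or> f $ i = 1) \<and> (g $ i = - 1 \<or> g $ i = 0 \<or> g $ i = 1)" for i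
      using fg sign_vectorsD by blast
    show "{i. f $ i = 1} \<union> {i. g $ i = 1} - ({i. f $ i = - 1} \<union> {i. g $ i = - 1})
      = {i. sign_join f g $ i = 1}"
    proof (rule set_eqI)
      fix i
      show "i \<in> {i. f $ i = 1} \<union> {i. g $ i = 1} - ({i. f $ i = - 1} \<union> {i. g $ i = - 1})
        \<longleftrightarrow> i \<in> {i. sign_join f g $ i = 1}"
        using *[of i] by (auto simp: sign_join_def)
    qed
    show "{i. f $ i = - 1} \<union> {i. g $ i = - 1} - ({i. f $ i = 1} \<union> {i. g $ i = 1})
      = {i. sign_join f g $ i = - 1}"
    proof (rule set_eqI)
      fix i
      show "i \<in> {i. f $ i = - 1} \<union> {i. g $ i = - 1} - ({i. f $ i = 1} \<union> {i. g $ i = 1})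
        \<longleftrightarrow> i \<in> {i. sign_join f g $ i = - 1}"
        using *[of i] by (auto simp: sign_join_def)
    qed
    show "{i. f $ i = 1} \<inter> {i. g $ i = 1} = {i. sign_meet f g $ i = 1}"
      by (auto simp: sign_meet_def split: if_splits)
    show "{i. f $ i = - 1} \<inter> {i. g $ i = - 1} = {i. sign_meet f g $ i = - 1}"
      by (auto simp: sign_meet_def split: if_splits)
  qed
  show ?thesis
    unfolding bisubmodular_def sign_bisubmodular_def ball_disjoint_pairs_iff
    by (simp add: sign_fun_def join_pos join_neg meet_pos meet_neg)
qed

section \<open>Finiteness and integrality of sets of integer vectors\<close>

lemma finite_bounded_int_vectors:
  fixes C :: "(real ^ 'n) set"
  assumes "C \<subseteq> int_vectors" "bounded C"
  shows "finite C"
proof -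
  obtain B where B: "norm x \<le> B" if "x \<in> C" for x
    using assms(2) by (auto simp: bounded_iff)
  let ?A = "real_of_int ` {- \<lceil>B\<rceil>..\<lceil>B\<rceil>}"
  have "C \<subseteq> vec_lambda ` (UNIV \<rightarrow>\<^sub>E ?A)"
  proof
    fix x assume x: "x \<in> C"
    have "x $ i \<in> ?A" for i
    proof -
      have "x $ i \<in> \<int>" using assms(1) x by (auto simp: int_vectors_def)
      then obtain k where k: "x $ i = of_int k" by (elim Ints_cases)
      have "\<bar>x $ i\<bar> \<le> B" using component_le_norm_cart[of x i] B[OF x] by linarith
      then have "\<bar>k\<bar> \<le> \<lceil>B\<rceil>" using k by linarith
      then show ?thesis using k by (auto simp: abs_le_iff)
    qed
    then have "vec_nth x \<in> UNIV \<rightarrow>\<^sub>E ?A" by auto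
    then show "x \<in> vec_lambda ` (UNIV \<rightarrow>\<^sub>E ?A)"
      by (metis image_eqI vec_nth_inverse)
  qed
  moreover have "finite (UNIV \<rightarrow>\<^sub>E ?A :: ('n \<Rightarrow> real) set)" by (intro finite_PiE) auto
  ultimately show ?thesis using finite_surj by blast
qed

lemma inner_int_vectors:
  "x \<in> int_vectors \<Longrightarrow> y \<in> int_vectors \<Longrightarrow> x \<bullet> y \<in> \<int>"
  unfolding int_vectors_def inner_vec_def by (auto intro!: Ints_sum)

lemma sign_vectors_subset_int: "f \<in> sign_vectors \<Longrightarrow> f \<in> int_vectors"
  unfolding int_vectors_def sign_vectors_def by clarsimp (metis Ints_0 Ints_1 Ints_minus)

subsection \<open>Abel summation and decreasing enumerations\<close>

text \<open>Abel summation in the form of an inequality: nonpositive prefix sums stay nonpositive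
  under nonnegative decreasing weights.\<close>

lemma weighted_sum_le:
  fixes w a :: "nat \<Rightarrow> real"
  assumes "\<And>k. k \<le> n \<Longrightarrow> (\<Sum>i<k. a i) \<le> 0"
    and "\<And>i. i < n \<Longrightarrow> 0 \<le> w i" and "\<And>i. Suc i < n \<Longrightarrow> w (Suc i) \<le> w i"
  shows "(\<Sum>i<n. w i * a i) \<le> 0"
proof (cases n)
  case (Suc m)
  \<comment> \<open>Strengthening for the induction: all weights may be lowered to the last one
    used, since a smaller factor only raises a nonpositive prefix sum.\<close>
  have "(\<Sum>i<k. w i * a i) \<le> w (k - 1) * (\<Sum>i<k. a i)" if "0 < k" "k \<le> n" for k
    using that
  proof (induction k)
    case (Suc k)
    show ?case
    proof (cases "k = 0")
      case False
      then have IH: "(\<Sum>i<k. w i * a i) \<le> w (k - 1) * (\<Sum>i<k. a i)" using Suc by simp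
      have "w k \<le> w (k - 1)" using assms(3)[of "k - 1"] Suc False by simp
      moreover have "(\<Sum>i<k. a i) \<le> 0" using assms(1) Suc by simp
      ultimately have "w (k - 1) * (\<Sum>i<k. a i) \<le> w k * (\<Sum>i<k. a i)"
        by (rule mult_right_mono_neg)
      then show ?thesis using IH by (simp add: algebra_simps)
    qed simp
  qed simp
  from this[of n] have "(\<Sum>i<n. w i * a i) \<le> w (n - 1) * (\<Sum>i<n. a i)" using Suc by simp
  also have "\<dots> \<le> 0"
    by (rule mult_nonneg_nonpos) (use assms(1)[of n] assms(2)[of "n - 1"] Suc in auto)
  finally show ?thesis .
qed simp

text \<open>Along \<open>\<rho>\<close> the inner product with \<open>v\<close> is a weighted sum of
  the signed entries, with decreasing weights \<open>\<bar>v $ \<rho> i\<bar>\<close>. Abel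
  summation thus reduces the comparison to signed prefix sums.\<close>

lemma inner_le_of_prefix_sums_le:
  fixes \<rho> :: "nat \<Rightarrow> 'n::finite" and v s x y :: "real ^ 'n"
  assumes \<rho>: "bij_betw \<rho> {..<CARD('n)} UNIV"
    and sv: "\<And>i. v $ i = s $ i * \<bar>v $ i\<bar>"
    and anti: "\<And>i. Suc i < CARD('n) \<Longrightarrow> \<bar>v $ \<rho> (Suc i)\<bar> \<le> \<bar>v $ \<rho> i\<bar>"
    and le: "\<And>k. k \<le> CARD('n) \<Longrightarrow> (\<Sum>i<k. s $ \<rho> i * x $ \<rho> i) \<le> (\<Sum>i<k. s $ \<rho> i * y $ \<rho> i)"
  shows "v \<bullet> x \<le> v \<bullet> y"
proof -
  have "v \<bullet> z = (\<Sum>i<CARD('n). \<bar>v $ \<rho> i\<bar> * (s $ \<rho> i * z $ \<rho> i))" for z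
  proof -
    have "v \<bullet> z = (\<Sum>j\<in>UNIV. \<bar>v $ j\<bar> * (s $ j * z $ j))"
      unfolding inner_vec_def using sv by (intro sum.cong) (auto simp: algebra_simps)
    then show ?thesis by (simp add: sum.reindex_bij_betw[OF \<rho>, symmetric])
  qed
  moreover have "(\<Sum>i<CARD('n). \<bar>v $ \<rho> i\<bar> * (s $ \<rho> i * x $ \<rho> i - s $ \<rho> i * y $ \<rho> i)) \<le> 0"
    by (rule weighted_sum_le) (use anti le in \<open>auto simp: sum_subtractf\<close>)
  ultimately show ?thesis by (simp add: right_diff_distrib sum_subtractf)
qed

text \<open>A sorted list is determined by its multiset, so every enumeration along which
  \<open>x\<close> decreases computes the rearrangement, however ties are broken.\<close>

lemma decreasing_rearrangement_eq:
  fixes \<rho> :: "nat \<Rightarrow> 'n::finite" and x :: "real ^ 'n"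
  assumes \<rho>: "bij_betw \<rho> {..<CARD('n)} UNIV"
    and anti: "\<And>i. Suc i < CARD('n) \<Longrightarrow> x $ \<rho> (Suc i) \<le> x $ \<rho> i"
  shows "decreasing_rearrangement x = map (\<lambda>i. x $ \<rho> i) [0..<CARD('n)]"
proof -
  let ?l = "map (\<lambda>i. x $ \<rho> i) [0..<CARD('n)]"
  have m: "mset ?l = image_mset (($) x) (mset_set UNIV)"
  proof -
    have "mset ?l = image_mset (($) x) (image_mset \<rho> (mset_set {..<CARD('n)}))"
      by (simp add: mset_map image_mset.compositionality comp_def lessThan_atLeast0)
    also have "image_mset \<rho> (mset_set {..<CARD('n)}) = mset_set UNIV"
      using \<rho> by (simp add: bij_betw_def image_mset_mset_set)
    finally show ?thesis .
  qed
  have "sorted (rev ?l)"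
    unfolding sorted_rev_iff_nth_Suc using anti by simp
  then have "sorted_list_of_multiset (mset (rev ?l)) = rev ?l"
    by (simp only: sorted_list_of_multiset_mset sorted_sort_id)
  then show ?thesis
    unfolding decreasing_rearrangement_def m[symmetric] by (simp only: mset_rev rev_rev_ident)
qed

lemma ex_decreasing_enumeration:
  fixes x :: "real ^ 'n::finite"
  obtains \<rho> :: "nat \<Rightarrow> 'n" where "bij_betw \<rho> {..<CARD('n)} UNIV"
    "\<And>i j. i \<le> j \<Longrightarrow> j < CARD('n) \<Longrightarrow> x $ \<rho> j \<le> x $ \<rho> i"
proof -
  obtain l :: "'n list" where l: "set l = UNIV" "distinct l"
    using finite_distinct_list[of "UNIV :: 'n set"] by auto
  define l' where "l' = sort_key (\<lambda>i. - x $ i) l"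
  have l': "set l' = UNIV" "distinct l'" "length l' = CARD('n)"
    using l by (auto simp: l'_def distinct_card[symmetric])
  have "bij_betw ((!) l') {..<CARD('n)} UNIV"
    by (rule bij_betw_nth) (use l' in auto)
  moreover have "sorted (map (\<lambda>i. - x $ i) l')" by (simp add: l'_def)
  then have "x $ (l' ! j) \<le> x $ (l' ! i)" if "i \<le> j" "j < CARD('n)" for i j
    using sorted_nth_mono[of "map (\<lambda>i. - x $ i) l'" i j] that l' by simp
  ultimately show thesis using that by blast
qed

subsection \<open>Prefix optima and bisubmodularity\<close>

text \<open>Condition (3) with positions counted from 0. The additional prefix \<open>k = 0\<close>
  is harmless because its sums are empty.\<close>

definition prefix_optimal :: "(real ^ 'n::finite) set \<Rightarrow> bool" where
  "prefix_optimal C \<longleftrightarrow> (\<forall>(\<rho> :: nat \<Rightarrow> 'n) (s :: real ^ 'n).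
     bij_betw \<rho> {..<CARD('n)} UNIV \<and> (\<forall>i. s $ i \<in> {- 1, 1}) \<longrightarrow>
     (\<exists>x'\<in>C. \<forall>x\<in>C. \<forall>k\<le>CARD('n).
        (\<Sum>i<k. s $ \<rho> i * x $ \<rho> i) \<le> (\<Sum>i<k. s $ \<rho> i * x' $ \<rho> i)))"

text \<open>Turns a signed prefix sum into the inner product with a sign vector, so that it is
  bounded by a constraint of the polyhedron.\<close>

definition prefix_vec :: "(nat \<Rightarrow> 'n) \<Rightarrow> real ^ 'n \<Rightarrow> nat \<Rightarrow> real ^ 'n" where
  "prefix_vec \<rho> s k = (\<chi> j. if j \<in> \<rho> ` {..<k} then s $ j else 0)"

lemma prefix_vec_sign: "(\<And>i. s $ i \<in> {- 1, 1}) \<Longrightarrow> prefix_vec \<rho> s k \<in> sign_vectors"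
  by (auto simp: prefix_vec_def sign_vectors_def)

lemma inner_prefix_vec:
  fixes \<rho> :: "nat \<Rightarrow> 'n::finite"
  assumes "bij_betw \<rho> {..<CARD('n)} UNIV" "k \<le> CARD('n)"
  shows "prefix_vec \<rho> s k \<bullet> x = (\<Sum>i<k. s $ \<rho> i * x $ \<rho> i)"
proof -
  have "inj_on \<rho> {..<k}"
    using assms by (meson bij_betw_imp_inj_on inj_on_subset lessThan_subset_iff)
  have "prefix_vec \<rho> s k \<bullet> x = (\<Sum>j\<in>UNIV. if j \<in> \<rho> ` {..<k} then s $ j * x $ j else 0)"
    unfolding inner_vec_def prefix_vec_def by (intro sum.cong) auto
  also have "\<dots> = (\<Sum>j\<in>\<rho> ` {..<k}. s $ j * x $ j)"
    by (simp add: sum.If_cases)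
  also have "\<dots> = (\<Sum>i<k. s $ \<rho> i * x $ \<rho> i)"
    by (simp add: sum.reindex[OF \<open>inj_on \<rho> {..<k}\<close>])
  finally show ?thesis .
qed

text \<open>The greedy point is forced by tightness on the chain of prefix vectors. That it
  satisfies all other constraints follows by uncrossing them with members of this chain.\<close>

lemma bisubmodular_greedy:
  fixes H :: "real ^ 'n::finite \<Rightarrow> real" and \<rho> :: "nat \<Rightarrow> 'n"
  assumes H: "sign_bisubmodular H" and int: "\<And>f. f \<in> sign_vectors \<Longrightarrow> H f \<in> \<int>"
    and \<rho>: "bij_betw \<rho> {..<CARD('n)} UNIV" and s: "\<And>i. s $ i \<in> {- 1, 1}"
  obtains x where "x \<in> sign_polyhedron H"
    "\<And>k. k \<le> CARD('n) \<Longrightarrow> prefix_vec \<rho> s k \<bullet> x = H (prefix_vec \<rho> s k)"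
proof -
  let ?n = "CARD('n)" and ?p = "prefix_vec \<rho> s"
  \<comment> \<open>The signed entries are the increments of \<open>H\<close> along the chain of
    prefix vectors, so the prefix sums telescope.\<close>
  define x :: "real ^ 'n" where "x = (\<chi> j. let i = inv_into {..<?n} \<rho> j in s $ j * (H (?p (Suc i)) - H (?p i)))"
  have inj: "inj_on \<rho> {..<?n}" using \<rho> by (simp add: bij_betw_def)
  have ss: "s $ i * s $ i = 1" for i using s[of i] by auto
  have x: "s $ \<rho> i * x $ \<rho> i = H (?p (Suc i)) - H (?p i)" if "i < ?n" for i
    using inv_into_f_f[OF inj, of i] that ss[of "\<rho> i"] by (simp add: x_def Let_def mult.assoc[symmetric])
  have p0: "?p 0 = 0" by (simp add: prefix_vec_def vec_eq_iff)
  have H0: "H 0 = 0" using H by (simp add: sign_bisubmodular_def)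
  have sub: "H (sign_join f g) + H (sign_meet f g) \<le> H f + H g"
    if "f \<in> sign_vectors" "g \<in> sign_vectors" for f g
    using H that by (simp add: sign_bisubmodular_def)
  have p_sign: "?p k \<in> sign_vectors" for k by (rule prefix_vec_sign) (rule s)
  have tight: "?p k \<bullet> x = H (?p k)" if "k \<le> ?n" for k
  proof -
    have "?p k \<bullet> x = (\<Sum>i<k. H (?p (Suc i)) - H (?p i))"
      using that x by (simp add: inner_prefix_vec[OF \<rho>])
    also have "\<dots> = H (?p k)" using sum_lessThan_telescope[of "\<lambda>i. H (?p i)" k] by (simp add: p0 H0)
    finally show ?thesis .
  qed
  \<comment> \<open>Induction on the length of a prefix containing the support of
    \<open>g\<close>.\<close>
  have feasible: "g \<bullet> x \<le> H g"
    if "k \<le> ?n" "g \<in> sign_vectors" "\<And>j. j \<notin> \<rho> ` {..<k} \<Longrightarrow> g $ j = 0" for k g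
    using that
  proof (induction k arbitrary: g)
    case 0
    then have "g = 0" by (simp add: vec_eq_iff)
    then show ?case by (simp add: H0)
  next
    case (Suc k)
    let ?e = "\<rho> k"
    have k: "k < ?n" using Suc.prems by simp
    have e: "?e \<notin> \<rho> ` {..<k}" using inj_onD[OF inj, of k] k by fastforce
    have out: "g $ j = 0" if "j \<notin> \<rho> ` {..<k}" "j \<noteq> ?e" for j
      using Suc.prems(3)[of j] that by (auto simp: lessThan_Suc)
    note IH = Suc.IH[OF less_imp_le[OF k]]
    have gs: "g $ j = - 1 \<or> g $ j = 0 \<or> g $ j = 1" for j using Suc.prems(2) sign_vectorsD by blast
    have sj: "s $ j = - 1 \<or> s $ j = 1" for j using s[of j] by auto
    have pk: "?p k $ j = (if j \<in> \<rho> ` {..<k} then s $ j else 0)" for j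
      by (simp add: prefix_vec_def)
    have pSk: "?p (Suc k) $ j = (if j \<in> \<rho> ` {..<k} \<or> j = ?e then s $ j else 0)" for j
      by (auto simp: prefix_vec_def lessThan_Suc)
    consider "g $ ?e = 0" | "g $ ?e = s $ ?e" | "g $ ?e = - s $ ?e"
      using gs[of ?e] sj[of ?e] by auto
    then show ?case
    proof cases
      case 1
      show ?thesis by (rule IH) (use Suc.prems out 1 in auto)
    next
      case 2
      \<comment> \<open>One join with \<open>?p k\<close> only cancels the entries where
        \<open>g\<close> opposes \<open>s\<close>; a second join restores them and reaches
        \<open>?p (Suc k)\<close>, which is tight. Both meets live on the first \<open>k\<close>
        positions, where the induction hypothesis applies.\<close>
      define a where "a = sign_join g (?p k)"
      define m where "m = sign_meet g (?p k)"
      define a' where "a' = sign_meet a (?p k)"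
      have sv: "a \<in> sign_vectors" "m \<in> sign_vectors" "a' \<in> sign_vectors"
        using Suc.prems(2) p_sign by (simp_all add: a_def m_def a'_def)
      have join: "sign_join a (?p k) = ?p (Suc k)"
      proof (simp only: vec_eq_iff, rule allI)
        fix j
        show "sign_join a (?p k) $ j = ?p (Suc k) $ j"
          using gs[of j] sj[of j] out[of j] 2 e unfolding a_def sign_join_def pSk by (auto simp: pk)
      qed
      have m0: "m $ j = 0" if "j \<notin> \<rho> ` {..<k}" for j
        using that by (simp add: m_def sign_meet_def pk)
      have a'0: "a' $ j = 0" if "j \<notin> \<rho> ` {..<k}" for j
        using that by (simp add: a'_def sign_meet_def pk)
      have "H a + H m \<le> H g + H (?p k)" "H (?p (Suc k)) + H a' \<le> H a + H (?p k)"
        using sub[OF Suc.prems(2) p_sign[of k]] sub[OF sv(1) p_sign[of k]]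
        by (simp_all add: a_def m_def a'_def join[unfolded a_def])
      moreover have "m \<bullet> x \<le> H m" "a' \<bullet> x \<le> H a'" using IH sv m0 a'0 by auto
      moreover have "a \<bullet> x + m \<bullet> x = g \<bullet> x + ?p k \<bullet> x" "?p (Suc k) \<bullet> x + a' \<bullet> x = a \<bullet> x + ?p k \<bullet> x"
        using inner_join_meet[OF Suc.prems(2) p_sign[of k]] inner_join_meet[OF sv(1) p_sign[of k]]
        by (simp_all add: a_def m_def a'_def join[unfolded a_def])
      moreover have "?p k \<bullet> x = H (?p k)" "?p (Suc k) \<bullet> x = H (?p (Suc k))"
        using tight k by auto
      ultimately show ?thesis by linarith
    next
      case 3
      \<comment> \<open>Here \<open>g\<close> opposes \<open>s\<close> at the new position, so both
        join and meet with \<open>?p (Suc k)\<close> vanish there and a single uncrossing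
        suffices.\<close>
      define a where "a = sign_join g (?p (Suc k))"
      define m where "m = sign_meet g (?p (Suc k))"
      have sv: "a \<in> sign_vectors" "m \<in> sign_vectors"
        using Suc.prems(2) p_sign by (simp_all add: a_def m_def)
      have m0: "m $ j = 0" if "j \<notin> \<rho> ` {..<k}" for j
        using that 3 sj[of j] by (auto simp: m_def sign_meet_def pSk out)
      have a0: "a $ j = 0" if "j \<notin> \<rho> ` {..<k}" for j
        using that 3 by (auto simp: a_def sign_join_def pSk out)
      have "H a + H m \<le> H g + H (?p (Suc k))"
        using sub[OF Suc.prems(2) p_sign[of "Suc k"]] by (simp add: a_def m_def)
      moreover have "m \<bullet> x \<le> H m" "a \<bullet> x \<le> H a" using IH sv m0 a0 by auto
      moreover have "a \<bullet> x + m \<bullet> x = g \<bullet> x + ?p (Suc k) \<bullet> x"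
        using inner_join_meet[OF Suc.prems(2) p_sign[of "Suc k"]] by (simp add: a_def m_def)
      moreover have "?p (Suc k) \<bullet> x = H (?p (Suc k))"
        using tight k by auto
      ultimately show ?thesis by linarith
    qed
  qed
  have "x $ j \<in> \<int>" for j
  proof -
    have "s $ j \<in> \<int>" using s[of j] by auto
    then show ?thesis using int[OF p_sign] by (simp add: x_def Let_def)
  qed
  moreover have "g \<bullet> x \<le> H g" if "g \<in> sign_vectors" for g
    by (rule feasible[of ?n]) (use that \<rho> in \<open>auto simp: bij_betw_def\<close>)
  ultimately have "x \<in> sign_polyhedron H"
    by (simp add: sign_polyhedron_def int_vectors_def)
  then show thesis using that tight by blast
qed

text \<open>The greedy point attains the bound \<open>H\<close> on every prefix vector, and no point
  of the polyhedron can exceed it.\<close>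

lemma prefix_optimal_of_bisubmodular:
  fixes H :: "real ^ 'n::finite \<Rightarrow> real"
  assumes "sign_bisubmodular H" "\<And>f. f \<in> sign_vectors \<Longrightarrow> H f \<in> \<int>"
  shows "prefix_optimal (sign_polyhedron H)"
  unfolding prefix_optimal_def
proof (intro allI impI, elim conjE)
  fix \<rho> :: "nat \<Rightarrow> 'n" and s :: "real ^ 'n"
  assume \<rho>: "bij_betw \<rho> {..<CARD('n)} UNIV" and s: "\<forall>i. s $ i \<in> {- 1, 1}"
  obtain x' where x': "x' \<in> sign_polyhedron H"
    "\<And>k. k \<le> CARD('n) \<Longrightarrow> prefix_vec \<rho> s k \<bullet> x' = H (prefix_vec \<rho> s k)"
    using bisubmodular_greedy[OF assms \<rho>] s by blast
  have "prefix_vec \<rho> s k \<bullet> x \<le> prefix_vec \<rho> s k \<bullet> x'"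
    if "x \<in> sign_polyhedron H" "k \<le> CARD('n)" for x k
    using that x'(2) prefix_vec_sign[of s \<rho> k] s by (simp add: sign_polyhedron_def)
  then show "\<exists>x'\<in>sign_polyhedron H. \<forall>x\<in>sign_polyhedron H. \<forall>k\<le>CARD('n).
      (\<Sum>i<k. s $ \<rho> i * x $ \<rho> i) \<le> (\<Sum>i<k. s $ \<rho> i * x' $ \<rho> i)"
    using x'(1) by (auto simp: inner_prefix_vec[OF \<rho>])
qed

section \<open>From prefix optima to the bisubmodular polyhedron\<close>

lemma sign_fun_support_fun:
  assumes "f \<in> sign_vectors"
  shows "sign_fun (support_fun C) f = Max ((\<lambda>x. f \<bullet> x) ` C)"
  by (simp add: sign_fun_def support_fun_def vsum_diff_eq_inner[OF assms])

text \<open>Sorting by \<open>\<bar>a $ i\<bar>\<close> and taking the signs of \<open>a\<close>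
  (with 0 counted as positive) gives one prefix optimum \<open>x'\<close> that serves all
  functionals \<open>v\<close> comonotone with \<open>a\<close>. The competitor \<open>x\<close>
  need not lie in \<open>C\<close>: it is enough that each sign functional at \<open>x\<close> is
  dominated by a point of \<open>C\<close>, so points of the polyhedron are covered too.\<close>

lemma prefix_optimal_comonotone:
  fixes C :: "(real ^ 'n::finite) set" and a :: "real ^ 'n"
  assumes opt: "prefix_optimal C"
  obtains x' where "x' \<in> C"
    "\<And>v x. (\<And>i. v $ i = (if 0 \<le> a $ i then 1 else - 1) * \<bar>v $ i\<bar>) \<Longrightarrow>
       (\<And>i j. \<bar>a $ i\<bar> \<le> \<bar>a $ j\<bar> \<Longrightarrow> \<bar>v $ i\<bar> \<le> \<bar>v $ j\<bar>) \<Longrightarrow>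
       (\<And>f. f \<in> sign_vectors \<Longrightarrow> \<exists>y\<in>C. f \<bullet> x \<le> f \<bullet> y) \<Longrightarrow> v \<bullet> x \<le> v \<bullet> x'"
proof -
  define s :: "real ^ 'n" where "s = (\<chi> i. if 0 \<le> a $ i then 1 else - 1)"
  obtain \<rho> :: "nat \<Rightarrow> 'n" where \<rho>: "bij_betw \<rho> {..<CARD('n)} UNIV"
    and anti: "\<And>i j. i \<le> j \<Longrightarrow> j < CARD('n) \<Longrightarrow> (\<chi> i. \<bar>a $ i\<bar>) $ \<rho> j \<le> (\<chi> i. \<bar>a $ i\<bar>) $ \<rho> i"
    using ex_decreasing_enumeration by blast
  have s: "\<forall>i. s $ i \<in> {- 1, 1}" by (simp add: s_def)
  obtain x' where x': "x' \<in> C" "\<forall>x\<in>C. \<forall>k\<le>CARD('n).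
      (\<Sum>i<k. s $ \<rho> i * x $ \<rho> i) \<le> (\<Sum>i<k. s $ \<rho> i * x' $ \<rho> i)"
    using opt \<rho> s unfolding prefix_optimal_def by blast
  show thesis
  proof (rule that[OF x'(1)])
    fix v x :: "real ^ 'n"
    assume v: "\<And>i. v $ i = (if 0 \<le> a $ i then 1 else - 1) * \<bar>v $ i\<bar>"
      "\<And>i j. \<bar>a $ i\<bar> \<le> \<bar>a $ j\<bar> \<Longrightarrow> \<bar>v $ i\<bar> \<le> \<bar>v $ j\<bar>"
      and x: "\<And>f. f \<in> sign_vectors \<Longrightarrow> \<exists>y\<in>C. f \<bullet> x \<le> f \<bullet> y"
    show "v \<bullet> x \<le> v \<bullet> x'"
    proof (rule inner_le_of_prefix_sums_le[OF \<rho>])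
      show "v $ i = s $ i * \<bar>v $ i\<bar>" for i using v(1)[of i] by (simp add: s_def)
      show "\<bar>v $ \<rho> (Suc i)\<bar> \<le> \<bar>v $ \<rho> i\<bar>" if "Suc i < CARD('n)" for i
        using v(2) anti[of i "Suc i"] that by simp
      fix k assume k: "k \<le> CARD('n)"
      obtain y where "y \<in> C" "prefix_vec \<rho> s k \<bullet> x \<le> prefix_vec \<rho> s k \<bullet> y"
        using x prefix_vec_sign[of s \<rho> k] s by blast
      then show "(\<Sum>i<k. s $ \<rho> i * x $ \<rho> i) \<le> (\<Sum>i<k. s $ \<rho> i * x' $ \<rho> i)"
        using x'(2) k by (force simp: inner_prefix_vec[OF \<rho> k])
    qed
  qed
qed

lemma bisubmodular_of_prefix_optimal:
  fixes C :: "(real ^ 'n::finite) set"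
  assumes int: "C \<subseteq> int_vectors" and fin: "finite C" and hf: "hole_free C"
    and opt: "prefix_optimal C"
  defines "H \<equiv> sign_fun (support_fun C)"
  shows "\<forall>f\<in>sign_vectors. H f \<in> \<int>" "sign_bisubmodular H" "C = sign_polyhedron H"
proof -
  \<comment> \<open>Prefix optimality asserts existence in \<open>C\<close>, so \<open>C\<close> is
    nonempty and the maximum defining \<open>H\<close> is attained.\<close>
  obtain x0 where x0: "x0 \<in> C" using prefix_optimal_comonotone[OF opt, of 0] by blast
  have ne: "(\<lambda>x. f \<bullet> x) ` C \<noteq> {}" for f using x0 by blast
  have H_ge: "f \<bullet> x \<le> H f" if "f \<in> sign_vectors" "x \<in> C" for f x
    using that fin by (simp add: H_def sign_fun_support_fun)
  have H_in: "\<exists>x\<in>C. H f = f \<bullet> x" if "f \<in> sign_vectors" for f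
    using Max_in[OF finite_imageI[OF fin] ne[of f]] that by (auto simp: H_def sign_fun_support_fun)
  show "\<forall>f\<in>sign_vectors. H f \<in> \<int>"
  proof
    fix f :: "real ^ 'n" assume f: "f \<in> sign_vectors"
    then obtain x where "x \<in> C" "H f = f \<bullet> x" using H_in by blast
    then show "H f \<in> \<int>" using inner_int_vectors[OF sign_vectors_subset_int[OF f]] int by auto
  qed
  show "sign_bisubmodular H"
    unfolding sign_bisubmodular_def
  proof (intro conjI ballI)
    show "H 0 = 0" using H_in[of 0] by simp
    fix f g :: "real ^ 'n" assume f: "f \<in> sign_vectors" and g: "g \<in> sign_vectors"
    obtain x' where x': "x' \<in> C"
      "\<And>v x. (\<And>i. v $ i = (if 0 \<le> (f + g) $ i then 1 else - 1) * \<bar>v $ i\<bar>) \<Longrightarrow>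
       (\<And>i j. \<bar>(f + g) $ i\<bar> \<le> \<bar>(f + g) $ j\<bar> \<Longrightarrow> \<bar>v $ i\<bar> \<le> \<bar>v $ j\<bar>) \<Longrightarrow>
       (\<And>f. f \<in> sign_vectors \<Longrightarrow> \<exists>y\<in>C. f \<bullet> x \<le> f \<bullet> y) \<Longrightarrow> v \<bullet> x \<le> v \<bullet> x'"
      using prefix_optimal_comonotone[OF opt] by blast
    have sv: "(f $ j = - 1 \<or> f $ j = 0 \<or> f $ j = 1) \<and> (g $ j = - 1 \<or> g $ j = 0 \<or> g $ j = 1)" for j
      using f g sign_vectorsD by blast
    \<comment> \<open>The join is nonzero exactly where \<open>\<bar>(f + g) $ i\<bar>\<close> is at
      least 1, the meet exactly where it is 2. Both are therefore comonotone with
      \<open>f + g\<close>, and the same \<open>x'\<close> maximises both.\<close>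
    have "sign_join f g \<bullet> x \<le> sign_join f g \<bullet> x'" if "x \<in> C" for x
    proof (rule x'(2))
      show "sign_join f g $ i = (if 0 \<le> (f + g) $ i then 1 else - 1) * \<bar>sign_join f g $ i\<bar>" for i
        using sv[of i] by (auto simp: sign_join_def)
      show "\<bar>(f + g) $ i\<bar> \<le> \<bar>(f + g) $ j\<bar> \<Longrightarrow> \<bar>sign_join f g $ i\<bar> \<le> \<bar>sign_join f g $ j\<bar>" for i j
        by (auto simp: sign_join_def sgn_if)
    qed (use that in blast)
    moreover have "sign_meet f g \<bullet> x \<le> sign_meet f g \<bullet> x'" if "x \<in> C" for x
    proof (rule x'(2))
      show "sign_meet f g $ i = (if 0 \<le> (f + g) $ i then 1 else - 1) * \<bar>sign_meet f g $ i\<bar>" for i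
        using sv[of i] by (auto simp: sign_meet_def)
      show "\<bar>(f + g) $ i\<bar> \<le> \<bar>(f + g) $ j\<bar> \<Longrightarrow> \<bar>sign_meet f g $ i\<bar> \<le> \<bar>sign_meet f g $ j\<bar>" for i j
        using sv[of i] sv[of j] by (auto simp: sign_meet_def)
    qed (use that in blast)
    ultimately have "H (sign_join f g) + H (sign_meet f g) \<le> sign_join f g \<bullet> x' + sign_meet f g \<bullet> x'"
      by (metis H_in add_mono f g sign_vectors_join_meet(1,2))
    also have "\<dots> = f \<bullet> x' + g \<bullet> x'" by (rule inner_join_meet[OF f g])
    also have "\<dots> \<le> H f + H g" using H_ge f g x'(1) by (simp add: add_mono)
    finally show "H (sign_join f g) + H (sign_meet f g) \<le> H f + H g" .
  qed
  show "C = sign_polyhedron H"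
  proof
    show "C \<subseteq> sign_polyhedron H" using int H_ge by (auto simp: sign_polyhedron_def)
    show "sign_polyhedron H \<subseteq> C"
    proof
      fix x assume x: "x \<in> sign_polyhedron H"
      show "x \<in> C"
      proof (rule ccontr)
        assume "x \<notin> C"
        then have "x \<notin> convex hull C"
          using hf x by (auto simp: hole_free_def sign_polyhedron_def)
        moreover have "closed (convex hull C)"
          by (simp add: compact_imp_closed finite_imp_compact_convex_hull fin)
        ultimately obtain a b where ab: "a \<bullet> x < b" "\<And>y. y \<in> convex hull C \<Longrightarrow> b < a \<bullet> y"
          using separating_hyperplane_closed_point[OF convex_convex_hull] by metis
        obtain x' where x': "x' \<in> C"
          "\<And>v x. (\<And>i. v $ i = (if 0 \<le> (- a) $ i then 1 else - 1) * \<bar>v $ i\<bar>) \<Longrightarrow>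
           (\<And>i j. \<bar>(- a) $ i\<bar> \<le> \<bar>(- a) $ j\<bar> \<Longrightarrow> \<bar>v $ i\<bar> \<le> \<bar>v $ j\<bar>) \<Longrightarrow>
           (\<And>f. f \<in> sign_vectors \<Longrightarrow> \<exists>y\<in>C. f \<bullet> x \<le> f \<bullet> y) \<Longrightarrow> v \<bullet> x \<le> v \<bullet> x'"
          using prefix_optimal_comonotone[OF opt] by blast
        \<comment> \<open>The separating functional is comonotone with itself, and the constraints
          at \<open>x\<close> are attained on \<open>C\<close>; so \<open>x'\<close> would lie on
          the wrong side of the hyperplane.\<close>
        have "- a \<bullet> x \<le> - a \<bullet> x'"
        proof (rule x'(2))
          show "\<exists>y\<in>C. f \<bullet> x \<le> f \<bullet> y" if "f \<in> sign_vectors" for f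
            using x that H_in[OF that] unfolding sign_polyhedron_def by force
        qed auto
        then show False using ab(1) ab(2)[OF hull_inc[OF x'(1)]] by simp
      qed
    qed
  qed
qed

subsection \<open>Simultaneous minimisation of hinge sums\<close>

text \<open>The sign vector of minimal support that is tight at \<open>x\<close> and forbids moving the \<open>i\<close>-th entry of
  \<open>x + b\<close> towards \<open>0\<close> has the required signs: otherwise moving the entries \<open>i\<close> and \<open>j\<close> together would
  decrease the norm, and the constraint violated by that move would uncross to a smaller one.\<close>

lemma ex_tight_sign_vector:
  fixes H :: "real ^ 'n::finite \<Rightarrow> real" and x b :: "real ^ 'n"
  assumes H: "sign_bisubmodular H" and int: "\<And>f. f \<in> sign_vectors \<Longrightarrow> H f \<in> \<int>"
    and x: "x \<in> sign_polyhedron H" and b: "b \<in> int_vectors"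
    and min: "\<And>y. y \<in> sign_polyhedron H \<Longrightarrow> (x + b) \<bullet> (x + b) \<le> (y + b) \<bullet> (y + b)"
    and c: "0 \<le> c" "c \<in> \<int>" and i: "c < \<bar>(x + b) $ i\<bar>"
  shows "\<exists>f\<in>sign_vectors. f \<bullet> x = H f \<and> f $ i = - sgn ((x + b) $ i) \<and>
    (\<forall>j. f $ j \<noteq> 0 \<longrightarrow> f $ j * (x + b) $ j \<le> - c)"
proof -
  define z where "z = x + b"
  define \<sigma> where "\<sigma> = sgn (z $ i)"
  have zi: "c < \<bar>z $ i\<bar>" using i by (simp add: z_def)
  have \<sigma>: "\<sigma> = 1 \<or> \<sigma> = - 1" "\<sigma> * z $ i = \<bar>z $ i\<bar>"
    using zi c by (auto simp: \<sigma>_def sgn_if)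
  have x_int: "x \<in> int_vectors" using x by (simp add: sign_polyhedron_def)
  have z_int: "z $ j \<in> \<int>" for j using x_int b by (simp add: z_def int_vectors_def)
  have int_gap: "u + 1 \<le> v" if "u < v" "u \<in> \<int>" "v \<in> \<int>" for u v :: real
    using that by (auto elim!: Ints_cases)
  have zi1: "c + 1 \<le> \<bar>z $ i\<bar>" using int_gap zi c z_int[of i] by simp
  \<comment> \<open>The slack of a constraint at \<open>x\<close> is nonnegative and integral, hence
    0 or at least 1. It inherits the uncrossing inequality because the inner product is additive
    under join and meet.\<close>
  define sl where "sl f = H f - f \<bullet> x" for f
  have sl_ge: "0 \<le> sl f" if "f \<in> sign_vectors" for f
    using x that by (simp add: sl_def sign_polyhedron_def)
  have sl_int: "sl f \<in> \<int>" if "f \<in> sign_vectors" for f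
    using int[OF that] inner_int_vectors[OF sign_vectors_subset_int[OF that] x_int]
    by (simp add: sl_def)
  have sl_zero_or_ge: "sl f = 0 \<or> 1 \<le> sl f" if "f \<in> sign_vectors" for f
  proof -
    have "0 < sl f \<Longrightarrow> 1 \<le> sl f" using int_gap[of 0 "sl f"] sl_int[OF that] by simp
    then show ?thesis using sl_ge[OF that] by linarith
  qed
  have sl_sub: "sl (sign_join f g) + sl (sign_meet f g) \<le> sl f + sl g"
    if "f \<in> sign_vectors" "g \<in> sign_vectors" for f g
    using H that inner_join_meet[OF that, of x] unfolding sign_bisubmodular_def sl_def
    by (smt (verit, best))
  \<comment> \<open>Under the bound on \<open>d\<close>, the vector \<open>x - d\<close> would have
    smaller norm after the shift, so it must leave the polyhedron; the violated constraint is
    expressed through its slack at \<open>x\<close>.\<close>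
  have violated: "\<exists>f\<in>sign_vectors. sl f < - (f \<bullet> d)"
    if d: "d \<in> int_vectors" "d \<bullet> d < 2 * (z \<bullet> d)" for d
  proof -
    have "(x - d + b) \<bullet> (x - d + b) = z \<bullet> z - 2 * (z \<bullet> d) + d \<bullet> d"
      by (simp add: z_def inner_simps inner_commute)
    then have "x - d \<notin> sign_polyhedron H" using min[of "x - d"] d(2) by (auto simp: z_def)
    moreover have "x - d \<in> int_vectors" using x_int d(1) by (auto simp: int_vectors_def)
    ultimately obtain f where "f \<in> sign_vectors" "H f < f \<bullet> (x - d)"
      by (auto simp: sign_polyhedron_def not_le)
    then show ?thesis by (intro bexI[of _ f]) (simp_all add: sl_def inner_diff_right)
  qed
  define T where "T = {f \<in> sign_vectors. sl f = 0 \<and> f $ i = - \<sigma>}"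
  have "\<exists>f. f \<in> T"
  proof -
    \<comment> \<open>A unit step of entry \<open>i\<close> towards 0 shortens the shifted vector.
      The violated constraint has slack below 1, hence 0, and has entry \<open>- \<sigma>\<close> at
      \<open>i\<close>.\<close>
    have "axis i \<sigma> \<in> int_vectors" using \<sigma>(1) by (auto simp: int_vectors_def axis_def)
    moreover have "axis i \<sigma> \<bullet> axis i \<sigma> = 1" "z \<bullet> axis i \<sigma> = \<bar>z $ i\<bar>"
      using \<sigma> by (auto simp: inner_axis mult.commute)
    then have "axis i \<sigma> \<bullet> axis i \<sigma> < 2 * (z \<bullet> axis i \<sigma>)" using zi1 c(1) by linarith
    ultimately obtain f where f: "f \<in> sign_vectors" "sl f < - (f $ i * \<sigma>)"
      using violated[of "axis i \<sigma>"] by (fastforce simp: inner_axis)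
    then have "f $ i = - \<sigma>" "sl f < 1"
      using sl_ge[OF f(1)] \<sigma>(1) sign_vectorsD[OF f(1), of i] by (elim disjE; simp)+
    moreover have "sl f = 0" using sl_zero_or_ge[OF f(1)] \<open>sl f < 1\<close> by linarith
    ultimately show ?thesis using f by (auto simp: T_def)
  qed
  then obtain f where f: "f \<in> T" "\<And>g. g \<in> T \<Longrightarrow> card {j. f $ j \<noteq> 0} \<le> card {j. g $ j \<noteq> 0}"
    using ex_has_least_nat[of "\<lambda>f. f \<in> T" _ "\<lambda>f. card {j. f $ j \<noteq> 0}"] by blast
  have fs: "f \<in> sign_vectors" "sl f = 0" "f $ i = - \<sigma>" using f(1) by (auto simp: T_def)
  \<comment> \<open>Uncrossing two members of \<open>T\<close> leaves the meet in \<open>T\<close>,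
    with support inside that of \<open>f\<close>. Minimality makes the supports equal, so
    \<open>g\<close> agrees with \<open>f\<close> there.\<close>
  have agree: "g $ j = f $ j" if g: "g \<in> T" and j: "f $ j \<noteq> 0" for g j
  proof -
    have gs: "g \<in> sign_vectors" "sl g = 0" "g $ i = - \<sigma>" using g by (auto simp: T_def)
    have "sl (sign_meet f g) = 0"
      using sl_sub[OF fs(1) gs(1)] sl_ge[of "sign_join f g"] sl_ge[of "sign_meet f g"] fs gs by simp
    moreover have "sign_meet f g $ i = - \<sigma>" using fs gs by (simp add: sign_meet_def)
    ultimately have "sign_meet f g \<in> T" using fs gs by (simp add: T_def)
    then have "card {j. f $ j \<noteq> 0} \<le> card {j. sign_meet f g $ j \<noteq> 0}" by (rule f(2))
    moreover have "{j. sign_meet f g $ j \<noteq> 0} \<subseteq> {j. f $ j \<noteq> 0}" by (auto simp: sign_meet_def)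
    ultimately have "{j. sign_meet f g $ j \<noteq> 0} = {j. f $ j \<noteq> 0}" by (simp add: card_subset_eq card_mono le_antisym)
    then have "sign_meet f g $ j \<noteq> 0" using j by blast
    then show ?thesis by (auto simp: sign_meet_def split: if_splits)
  qed
  have "f $ j * z $ j \<le> - c" if j: "f $ j \<noteq> 0" for j
  proof (rule ccontr)
    assume neg: "\<not> f $ j * z $ j \<le> - c"
    define \<tau> where "\<tau> = f $ j"
    have \<tau>: "\<tau> = 1 \<or> \<tau> = - 1" using j sign_vectorsD[OF fs(1), of j] by (auto simp: \<tau>_def)
    have ij: "j \<noteq> i" using neg fs(3) \<sigma>(2) zi by auto
    have zj: "- c + 1 \<le> \<tau> * z $ j"
      using neg z_int[of j] c(2) \<tau> by (intro int_gap) (auto simp: \<tau>_def[symmetric])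
    \<comment> \<open>The failing sign condition and integrality give \<open>\<tau> * z $ j\<close>
      at least \<open>1 - c\<close>, while entry \<open>i\<close> contributes at least
      \<open>c + 1\<close>. So \<open>z \<bullet> d\<close> is at least 2, against
      \<open>d \<bullet> d = 2\<close>.\<close>
    define d where "d = axis i \<sigma> + axis j \<tau>"
    have "d \<in> int_vectors" using \<sigma>(1) \<tau> by (auto simp: d_def int_vectors_def axis_def)
    moreover have "d \<bullet> d < 2 * (z \<bullet> d)"
    proof -
      have "d \<bullet> d = 2" using ij \<sigma>(1) \<tau> by (auto simp: d_def inner_simps inner_axis_axis)
      moreover have "z \<bullet> d = \<sigma> * z $ i + \<tau> * z $ j" by (simp add: d_def inner_simps inner_axis mult.commute)
      ultimately show ?thesis using \<sigma>(2) zi1 zj by linarith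
    qed
    ultimately obtain g where g: "g \<in> sign_vectors" "sl g < - (g \<bullet> d)" using violated by blast
    have gd: "g \<bullet> d = g $ i * \<sigma> + g $ j * \<tau>" by (simp add: d_def inner_simps inner_axis)
    have gi: "g $ i = - 1 \<or> g $ i = 0 \<or> g $ i = 1" and gj: "g $ j = - 1 \<or> g $ j = 0 \<or> g $ j = 1"
      using g sign_vectorsD by blast+
    have sl_gap: "h \<in> T \<or> 1 \<le> sl h" if "h \<in> sign_vectors" "h $ i = - \<sigma>" for h
      using sl_zero_or_ge[OF that(1)] that by (simp add: T_def)
    have fj: "f $ j = \<tau>" by (simp add: \<tau>_def)
    have sl_g: "sl g = 0 \<or> 1 \<le> sl g"
      by (rule sl_zero_or_ge[OF g(1)])
    have sub: "sl (sign_join f g) + sl (sign_meet f g) \<le> sl g"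
      using sl_sub[OF fs(1) g(1)] fs(2) by simp
    have s1: "sign_join f g \<in> sign_vectors" "sign_meet f g \<in> sign_vectors" using fs g by simp_all
    have not_T: "h \<notin> T" if "h $ j \<noteq> \<tau>" for h using agree[of h j] j that fj by auto
    \<comment> \<open>If \<open>g $ i = - \<sigma>\<close>, then \<open>g\<close> has slack 1, and
      its join and meet with \<open>f\<close> both vanish at \<open>j\<close>, hence have slack at
      least 1 each. Otherwise \<open>g\<close> is tight and the join alone is too slack. Either way
      the uncrossing inequality fails.\<close>
    show False
    proof (cases "g $ i = - \<sigma>")
      case True
      have "g \<notin> T"
      proof
        assume "g \<in> T"
        then have "g $ j = \<tau>" using agree[of g j] j fj by simp
        then show False using True gd g(2) sl_ge[OF g(1)] \<sigma>(1) \<tau> by auto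
      qed
      then have "1 \<le> sl g" using sl_gap[OF g(1) True] by blast
      then have "g $ j = - \<tau>" "sl g < 2" using g(2) gd True \<sigma>(1) \<tau> gj by auto
      moreover from this have "1 \<le> sl (sign_join f g)"
        using sl_gap[OF s1(1)] not_T[of "sign_join f g"] fs(3) True \<sigma>(1) \<tau> fj
        by (auto simp: sign_join_def)
      moreover from \<open>g $ j = - \<tau>\<close> have "1 \<le> sl (sign_meet f g)"
        using sl_gap[OF s1(2)] not_T[of "sign_meet f g"] fs(3) True \<tau> fj
        by (auto simp: sign_meet_def)
      ultimately show False using sub by linarith
    next
      case False
      then have "g $ i = 0" "g $ j = - \<tau>" "sl g = 0"
        using gi gj g(2) gd \<sigma>(1) \<tau> sl_ge[OF g(1)] sl_g by auto
      then have "1 \<le> sl (sign_join f g)"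
        using sl_gap[OF s1(1)] not_T[of "sign_join f g"] fs(3) \<sigma>(1) \<tau> fj
        by (auto simp: sign_join_def)
      then show False using sub sl_ge[OF s1(2)] \<open>sl g = 0\<close> by linarith
    qed
  qed
  then show ?thesis using fs by (intro bexI[of _ f]) (simp_all add: z_def \<sigma>_def sl_def)
qed

text \<open>Joins the tight vectors of the single indices. Uncrossing keeps the join tight, and each
  nonzero entry of the join is an entry of one of the two vectors, so the level condition
  survives.\<close>

lemma ex_tight_level_sign_vector:
  fixes H :: "real ^ 'n::finite \<Rightarrow> real" and x b :: "real ^ 'n"
  assumes H: "sign_bisubmodular H" and int: "\<And>f. f \<in> sign_vectors \<Longrightarrow> H f \<in> \<int>"
    and x: "x \<in> sign_polyhedron H" and b: "b \<in> int_vectors"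
    and min: "\<And>y. y \<in> sign_polyhedron H \<Longrightarrow> (x + b) \<bullet> (x + b) \<le> (y + b) \<bullet> (y + b)"
    and c: "0 \<le> c" "c \<in> \<int>"
  shows "\<exists>f\<in>sign_vectors. f \<bullet> x = H f \<and>
    (\<forall>i. c < \<bar>(x + b) $ i\<bar> \<longrightarrow> f $ i = - sgn ((x + b) $ i)) \<and>
    (\<forall>j. f $ j \<noteq> 0 \<longrightarrow> f $ j * (x + b) $ j \<le> - c)"
proof -
  define z where "z = x + b"
  let ?P = "\<lambda>I f. f \<in> sign_vectors \<and> f \<bullet> x = H f \<and>
    (\<forall>i\<in>I. c < \<bar>z $ i\<bar> \<longrightarrow> f $ i = - sgn (z $ i)) \<and>
    (\<forall>j. f $ j \<noteq> 0 \<longrightarrow> f $ j * z $ j \<le> - c)"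
  have "\<exists>f. ?P I f" if "finite I" for I
    using that
  proof induction
    case empty
    show ?case using H by (intro exI[of _ 0]) (simp add: sign_bisubmodular_def)
  next
    case (insert i I)
    then obtain f where f: "?P I f" by blast
    show ?case
    proof (cases "c < \<bar>z $ i\<bar>")
      case False
      then show ?thesis using f by (intro exI[of _ f]) auto
    next
      case True
      then obtain g where g: "g \<in> sign_vectors" "g \<bullet> x = H g" "g $ i = - sgn (z $ i)"
        "\<forall>j. g $ j \<noteq> 0 \<longrightarrow> g $ j * z $ j \<le> - c"
        using ex_tight_sign_vector[OF H int x b min c, of i] by (auto simp: z_def)
      have fg: "f \<in> sign_vectors" "f \<bullet> x = H f" using f by auto
      have s: "sign_join f g \<in> sign_vectors" "sign_meet f g \<in> sign_vectors" using fg g by simp_all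
      have "H (sign_join f g) + H (sign_meet f g) \<le> H f + H g"
        using H fg g by (simp add: sign_bisubmodular_def)
      moreover have "sign_join f g \<bullet> x \<le> H (sign_join f g)" "sign_meet f g \<bullet> x \<le> H (sign_meet f g)"
        using x s by (simp_all add: sign_polyhedron_def)
      ultimately have tight: "sign_join f g \<bullet> x = H (sign_join f g)"
        using inner_join_meet[OF fg(1) g(1), of x] fg(2) g(2) by linarith
      have fj: "f $ j = - 1 \<or> f $ j = 0 \<or> f $ j = 1" and gj: "g $ j = - 1 \<or> g $ j = 0 \<or> g $ j = 1" for j
        using fg g sign_vectorsD by blast+
      have level: "sign_join f g $ j * z $ j \<le> - c" if "sign_join f g $ j \<noteq> 0" for j
      proof -
        have "sign_join f g $ j = f $ j \<and> f $ j \<noteq> 0 \<or> sign_join f g $ j = g $ j \<and> g $ j \<noteq> 0"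
          using that fj[of j] gj[of j] by (auto simp: sign_join_def)
        then show ?thesis using f g by metis
      qed
      have "sign_join f g $ k = - sgn (z $ k)" if "k \<in> insert i I" "c < \<bar>z $ k\<bar>" for k
      proof -
        have zk: "z $ k \<noteq> 0" using that c by auto
        \<comment> \<open>Above level \<open>c\<close> the level condition leaves only one nonzero
          sign, so the joined vectors never cancel there.\<close>
        have *: "h = 0 \<or> h = - sgn (z $ k)" if "h \<noteq> 0 \<longrightarrow> h * z $ k \<le> - c" "h = - 1 \<or> h = 0 \<or> h = 1" for h
          using that c zk by (auto simp: sgn_if)
        have "f $ k = 0 \<or> f $ k = - sgn (z $ k)" "g $ k = 0 \<or> g $ k = - sgn (z $ k)"
          using *[OF _ fj[of k]] *[OF _ gj[of k]] f g(4) by blast+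
        moreover have "f $ k = - sgn (z $ k) \<or> g $ k = - sgn (z $ k)" using that f g(3) by blast
        moreover have "sgn (- sgn (z $ k) + - sgn (z $ k)) = - sgn (z $ k)" by (auto simp: sgn_if)
        ultimately show ?thesis by (auto simp: sign_join_def sgn_minus)
      qed
      then show ?thesis using tight s(1) level by blast
    qed
  qed
  from this[OF finite, of UNIV] obtain f where "?P UNIV f" ..
  then show ?thesis unfolding z_def[symmetric] by (intro bexI[of _ f]) simp_all
qed

section \<open>Hinge sums and their duality bound\<close>

definition hinge_sum :: "real \<Rightarrow> real ^ 'n::finite \<Rightarrow> real" where
  "hinge_sum c x = (\<Sum>i\<in>UNIV. max (\<bar>x $ i\<bar> - c) 0)"

text \<open>Weak duality: for any sign vector \<open>f\<close>, the hinge sum is at least minus the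
  inner product with \<open>f\<close> minus \<open>c\<close> times the support size. For the tight
  level vector this bound is an equality at \<open>x + b\<close>, and tightness makes it no smaller
  at \<open>y + b\<close>.\<close>

lemma hinge_sum_minimal:
  fixes H :: "real ^ 'n::finite \<Rightarrow> real" and x b :: "real ^ 'n"
  assumes H: "sign_bisubmodular H" and int: "\<And>f. f \<in> sign_vectors \<Longrightarrow> H f \<in> \<int>"
    and x: "x \<in> sign_polyhedron H" and b: "b \<in> int_vectors"
    and min: "\<And>y. y \<in> sign_polyhedron H \<Longrightarrow> (x + b) \<bullet> (x + b) \<le> (y + b) \<bullet> (y + b)"
    and c: "0 \<le> c" "c \<in> \<int>" and y: "y \<in> sign_polyhedron H"
  shows "hinge_sum c (x + b) \<le> hinge_sum c (y + b)"
proof -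
  obtain f where f: "f \<in> sign_vectors" "f \<bullet> x = H f"
    "\<And>i. c < \<bar>(x + b) $ i\<bar> \<Longrightarrow> f $ i = - sgn ((x + b) $ i)"
    "\<And>j. f $ j \<noteq> 0 \<Longrightarrow> f $ j * (x + b) $ j \<le> - c"
    using ex_tight_level_sign_vector[OF H int x b min c] by blast
  have fi: "f $ i = - 1 \<or> f $ i = 0 \<or> f $ i = 1" for i using f(1) sign_vectorsD by blast
  have "hinge_sum c (x + b) = (\<Sum>i\<in>UNIV. - (f $ i * (x + b) $ i) - c * \<bar>f $ i\<bar>)"
    unfolding hinge_sum_def
  proof (rule sum.cong)
    fix i
    \<comment> \<open>At or below level \<open>c\<close> a nonzero \<open>f $ i\<close> forces
      absolute value exactly \<open>c\<close>, so both sides vanish.\<close>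
    show "max (\<bar>(x + b) $ i\<bar> - c) 0 = - (f $ i * (x + b) $ i) - c * \<bar>f $ i\<bar>"
      using fi[of i] f(3)[of i] f(4)[of i] c(1)
      by (cases "c < \<bar>(x + b) $ i\<bar>") (auto simp: sgn_if split: if_splits)
  qed simp
  also have "\<dots> = - (f \<bullet> (x + b)) - (\<Sum>i\<in>UNIV. c * \<bar>f $ i\<bar>)"
    by (simp add: inner_vec_def sum_subtractf sum_negf)
  also have "\<dots> \<le> - (f \<bullet> (y + b)) - (\<Sum>i\<in>UNIV. c * \<bar>f $ i\<bar>)"
    using y f(1,2) by (simp add: sign_polyhedron_def inner_add_right)
  also have "\<dots> = (\<Sum>i\<in>UNIV. - (f $ i * (y + b) $ i) - c * \<bar>f $ i\<bar>)"
    by (simp add: inner_vec_def sum_subtractf sum_negf)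
  also have "\<dots> \<le> hinge_sum c (y + b)"
    unfolding hinge_sum_def
  proof (rule sum_mono)
    fix i
    show "- (f $ i * (y + b) $ i) - c * \<bar>f $ i\<bar> \<le> max (\<bar>(y + b) $ i\<bar> - c) 0"
      using fi[of i] by auto
  qed
  finally show ?thesis .
qed

subsection \<open>Majorization and Schur-convexity\<close>

lemma decreasing_rearrangement_enumeration:
  fixes x :: "real ^ 'n::finite"
  obtains \<rho> :: "nat \<Rightarrow> 'n" where "bij_betw \<rho> {..<CARD('n)} UNIV"
    "\<And>i j. i \<le> j \<Longrightarrow> j < CARD('n) \<Longrightarrow> x $ \<rho> j \<le> x $ \<rho> i"
    "\<And>i. i < CARD('n) \<Longrightarrow> decreasing_rearrangement x ! i = x $ \<rho> i"
proof -
  obtain \<rho> :: "nat \<Rightarrow> 'n" where \<rho>: "bij_betw \<rho> {..<CARD('n)} UNIV"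
    "\<And>i j. i \<le> j \<Longrightarrow> j < CARD('n) \<Longrightarrow> x $ \<rho> j \<le> x $ \<rho> i"
    using ex_decreasing_enumeration by blast
  then have "decreasing_rearrangement x = map (\<lambda>i. x $ \<rho> i) [0..<CARD('n)]"
    by (intro decreasing_rearrangement_eq) auto
  then show thesis using that \<rho> by simp
qed

text \<open>Each of the \<open>k\<close> largest entries is at most \<open>c\<close> plus its excess
  over \<open>c\<close>, and the remaining excesses are nonnegative.\<close>

lemma top_sum_le:
  fixes x :: "real ^ 'n::finite"
  assumes "k \<le> CARD('n)"
  shows "(\<Sum>i<k. decreasing_rearrangement x ! i) \<le> real k * c + (\<Sum>j\<in>UNIV. max (x $ j - c) 0)"
proof -
  obtain \<rho> :: "nat \<Rightarrow> 'n" where \<rho>: "bij_betw \<rho> {..<CARD('n)} UNIV"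
    "\<And>i j. i \<le> j \<Longrightarrow> j < CARD('n) \<Longrightarrow> x $ \<rho> j \<le> x $ \<rho> i"
    "\<And>i. i < CARD('n) \<Longrightarrow> decreasing_rearrangement x ! i = x $ \<rho> i"
    using decreasing_rearrangement_enumeration[of x] by blast
  have "(\<Sum>i<k. decreasing_rearrangement x ! i) = (\<Sum>i<k. x $ \<rho> i)"
    using \<rho>(3) assms by simp
  also have "\<dots> \<le> (\<Sum>i<k. c + max (x $ \<rho> i - c) 0)" by (rule sum_mono) auto
  also have "\<dots> = real k * c + (\<Sum>i<k. max (x $ \<rho> i - c) 0)" by (simp add: sum.distrib)
  also have "\<dots> \<le> real k * c + (\<Sum>i<CARD('n). max (x $ \<rho> i - c) 0)"
    using assms by (intro add_left_mono sum_mono2) auto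
  also have "(\<Sum>i<CARD('n). max (x $ \<rho> i - c) 0) = (\<Sum>j\<in>UNIV. max (x $ j - c) 0)"
    by (rule sum.reindex_bij_betw[OF \<rho>(1)])
  finally show ?thesis .
qed

text \<open>The threshold bound loses nothing when \<open>c\<close> separates the \<open>k\<close>
  largest entries from the others.\<close>

lemma top_sum_eq:
  fixes x :: "real ^ 'n::finite"
  assumes k: "k \<le> CARD('n)"
    and ge: "\<And>i. i < k \<Longrightarrow> c \<le> decreasing_rearrangement x ! i"
    and le: "\<And>i. k \<le> i \<Longrightarrow> i < CARD('n) \<Longrightarrow> decreasing_rearrangement x ! i \<le> c"
  shows "(\<Sum>i<k. decreasing_rearrangement x ! i) = real k * c + (\<Sum>j\<in>UNIV. max (x $ j - c) 0)"
proof -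
  let ?d = "\<lambda>i. decreasing_rearrangement x ! i"
  obtain \<rho> :: "nat \<Rightarrow> 'n" where \<rho>: "bij_betw \<rho> {..<CARD('n)} UNIV"
    "\<And>i j. i \<le> j \<Longrightarrow> j < CARD('n) \<Longrightarrow> x $ \<rho> j \<le> x $ \<rho> i"
    "\<And>i. i < CARD('n) \<Longrightarrow> decreasing_rearrangement x ! i = x $ \<rho> i"
    using decreasing_rearrangement_enumeration[of x] by blast
  have "(\<Sum>j\<in>UNIV. max (x $ j - c) 0) = (\<Sum>i<CARD('n). max (?d i - c) 0)"
    using \<rho>(3) by (simp add: sum.reindex_bij_betw[OF \<rho>(1), symmetric])
  also have "\<dots> = (\<Sum>i<k. max (?d i - c) 0)"
    by (rule sum.mono_neutral_right) (use k le in auto)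
  also have "\<dots> = (\<Sum>i<k. ?d i) - real k * c"
    using ge by (simp add: sum_subtractf)
  finally show ?thesis by simp
qed

lemma ex_top_sum_eq:
  fixes x :: "real ^ 'n::finite"
  shows "\<exists>k\<le>CARD('n). (\<Sum>i<k. decreasing_rearrangement x ! i)
    = real k * c + (\<Sum>j\<in>UNIV. max (x $ j - c) 0)"
proof -
  let ?d = "\<lambda>i. decreasing_rearrangement x ! i"
  obtain \<rho> :: "nat \<Rightarrow> 'n" where \<rho>: "bij_betw \<rho> {..<CARD('n)} UNIV"
    "\<And>i j. i \<le> j \<Longrightarrow> j < CARD('n) \<Longrightarrow> x $ \<rho> j \<le> x $ \<rho> i"
    "\<And>i. i < CARD('n) \<Longrightarrow> decreasing_rearrangement x ! i = x $ \<rho> i"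
    using decreasing_rearrangement_enumeration[of x] by blast
  \<comment> \<open>The number of entries that are at least \<open>c\<close>; the first disjunct
    ensures that the minimum exists.\<close>
  define k where "k = (LEAST k. k = CARD('n) \<or> ?d k < c)"
  have k: "k = CARD('n) \<or> ?d k < c" unfolding k_def by (rule LeastI[of _ "CARD('n)"]) simp
  have kn: "k \<le> CARD('n)" unfolding k_def by (rule Least_le) simp
  have "c \<le> ?d i" if "i < k" for i using not_less_Least[of i] that by (force simp: k_def)
  moreover have "?d i \<le> c" if "k \<le> i" "i < CARD('n)" for i
    using k \<rho>(2)[of k i] \<rho>(3)[of i] \<rho>(3)[of k] that by auto
  ultimately show ?thesis using top_sum_eq[OF kn] kn by blast
qed

text \<open>The total excess over \<open>c\<close> is the maximum over \<open>k\<close> of the sum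
  of the \<open>k\<close> largest entries minus \<open>k * c\<close>, and majorization compares
  these sums for each \<open>k\<close>.\<close>

lemma majorized_pos_part_sum_le:
  fixes x y :: "real ^ 'n::finite"
  assumes "majorized x y"
  shows "(\<Sum>j\<in>UNIV. max (x $ j - c) 0) \<le> (\<Sum>j\<in>UNIV. max (y $ j - c) 0)"
proof -
  obtain k where k: "k \<le> CARD('n)"
    "(\<Sum>i<k. decreasing_rearrangement x ! i) = real k * c + (\<Sum>j\<in>UNIV. max (x $ j - c) 0)"
    using ex_top_sum_eq by blast
  have "(\<Sum>i<k. decreasing_rearrangement x ! i) \<le> (\<Sum>i<k. decreasing_rearrangement y ! i)"
    using assms k(1) by (cases "k = 0") (auto simp: majorized_def)
  then show ?thesis using top_sum_le[OF k(1), of y c] k(2) by linarith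
qed

lemma hinge_sum_schur_convex:
  assumes "0 \<le> c"
  shows "schur_convex (hinge_sum c :: real ^ 'n::finite \<Rightarrow> real)"
  unfolding schur_convex_def
proof (intro allI impI)
  fix x y :: "real ^ 'n" assume xy: "majorized x y"
  \<comment> \<open>Writes the even hinge as two one-sided hinges at \<open>c\<close> and
    \<open>- c\<close> plus an affine term, whose sum is fixed under majorization.\<close>
  have eq: "hinge_sum c z = (\<Sum>j\<in>UNIV. max (z $ j - c) 0) + (\<Sum>j\<in>UNIV. max (z $ j - (- c)) 0)
      - vsum z UNIV - real CARD('n) * c" for z :: "real ^ 'n"
  proof -
    have "hinge_sum c z = (\<Sum>j\<in>UNIV. max (z $ j - c) 0 + max (z $ j - (- c)) 0 - z $ j - c)"
      unfolding hinge_sum_def using assms by (intro sum.cong) auto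
    then show ?thesis by (simp add: sum.distrib sum_subtractf vsum_def)
  qed
  show "hinge_sum c x \<le> hinge_sum c y"
    using majorized_pos_part_sum_le[OF xy, of c] majorized_pos_part_sum_le[OF xy, of "- c"] xy
    by (simp add: eq majorized_def)
qed

lemma hinge_sum_monotonically_even:
  assumes "0 \<le> c"
  shows "monotonically_even (hinge_sum c :: real ^ 'n::finite \<Rightarrow> real)"
  unfolding monotonically_even_def
proof (intro allI conjI impI)
  fix i :: 'n and x :: "real ^ 'n" and \<epsilon> :: real
  show "hinge_sum c (replace_entry x i (- (x $ i))) = hinge_sum c x"
    unfolding hinge_sum_def by (intro sum.cong) (auto simp: replace_entry_def)
  show "hinge_sum c x \<le> hinge_sum c (replace_entry x i (x $ i - \<epsilon>))" if "\<epsilon> > 0" "x $ i \<le> 0"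
    unfolding hinge_sum_def using that by (intro sum_mono) (auto simp: replace_entry_def)
  show "hinge_sum c x \<le> hinge_sum c (replace_entry x i (x $ i + \<epsilon>))" if "\<epsilon> > 0" "0 \<le> x $ i"
    unfolding hinge_sum_def using that by (intro sum_mono) (auto simp: replace_entry_def)
qed

lemma hinge_sum_continuous: "continuous_on UNIV (hinge_sum c :: real ^ 'n::finite \<Rightarrow> real)"
  unfolding hinge_sum_def by (intro continuous_intros)

lemma convex_on_hinge: "convex_on UNIV (\<lambda>t::real. max (\<bar>t\<bar> - c) 0)"
proof (rule convex_onI)
  fix t x y :: real assume t: "0 < t" "t < 1"
  have "\<bar>(1 - t) * x + t * y\<bar> \<le> (1 - t) * \<bar>x\<bar> + t * \<bar>y\<bar>"
    using t abs_triangle_ineq[of "(1 - t) * x" "t * y"] by (simp add: abs_mult)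
  also have "\<dots> - c = (1 - t) * (\<bar>x\<bar> - c) + t * (\<bar>y\<bar> - c)" by (simp add: algebra_simps)
  also have "\<dots> \<le> (1 - t) * max (\<bar>x\<bar> - c) 0 + t * max (\<bar>y\<bar> - c) 0"
    using t by (intro add_mono mult_left_mono) auto
  finally show "max (\<bar>(1 - t) *\<^sub>R x + t *\<^sub>R y\<bar> - c) 0
      \<le> (1 - t) * max (\<bar>x\<bar> - c) 0 + t * max (\<bar>y\<bar> - c) 0"
    using t by simp
qed simp

text \<open>Entries of \<open>x\<close> are replaced by those of \<open>y\<close> one at a time;
  evenness reduces each replacement to increasing a nonnegative entry.\<close>

lemma monotonically_even_le:
  fixes x y :: "real ^ 'n::finite"
  assumes \<Phi>: "monotonically_even \<Phi>" and le: "\<And>i. \<bar>x $ i\<bar> \<le> \<bar>y $ i\<bar>"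
  shows "\<Phi> x \<le> \<Phi> y"
proof -
  have single: "\<Phi> (replace_entry z i s) \<le> \<Phi> (replace_entry z i t)" if "\<bar>s\<bar> \<le> \<bar>t\<bar>" for z i s t
  proof -
    have r: "replace_entry (replace_entry z i u) i v = replace_entry z i v" "replace_entry z i u $ i = u" for u v
      by (simp_all add: replace_entry_def vec_eq_iff)
    have even: "\<Phi> (replace_entry z i (- u)) = \<Phi> (replace_entry z i u)" for u
      using \<Phi> unfolding monotonically_even_def by (metis r)
    have "\<Phi> (replace_entry z i u) \<le> \<Phi> (replace_entry z i (u + \<epsilon>))" if "0 \<le> u" "0 < \<epsilon>" for u \<epsilon>
      using \<Phi> that unfolding monotonically_even_def by (metis r)
    from this[of "\<bar>s\<bar>" "\<bar>t\<bar> - \<bar>s\<bar>"]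
    have "\<Phi> (replace_entry z i \<bar>s\<bar>) \<le> \<Phi> (replace_entry z i \<bar>t\<bar>)"
      using that by (cases "\<bar>s\<bar> = \<bar>t\<bar>") auto
    moreover have "\<Phi> (replace_entry z i \<bar>u\<bar>) = \<Phi> (replace_entry z i u)" for u
      using even[of u] by (simp add: abs_if)
    ultimately show ?thesis by simp
  qed
  have "\<Phi> x \<le> \<Phi> (\<chi> i. if i \<in> I then y $ i else x $ i)" if "finite I" for I
    using that
  proof induction
    case (insert i I)
    let ?z = "\<chi> i. if i \<in> I then y $ i else x $ i"
    have "\<Phi> (replace_entry ?z i (x $ i)) \<le> \<Phi> (replace_entry ?z i (y $ i))"
      using single le by blast
    moreover have "replace_entry ?z i (x $ i) = ?z"
      using insert by (simp add: replace_entry_def vec_eq_iff)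
    moreover have "replace_entry ?z i (y $ i) = (\<chi> j. if j \<in> insert i I then y $ j else x $ j)"
      by (simp add: replace_entry_def vec_eq_iff)
    ultimately show ?case using insert.IH by simp
  qed simp
  from this[of UNIV] show ?thesis by simp
qed

text \<open>The intermediate vector \<open>u\<close> has the prefix sums of \<open>\<bar>w\<bar>\<close>, truncated at the total of \<open>\<bar>z\<bar>\<close>.\<close>

lemma schur_convex_le_of_hinge_sums:
  fixes z w :: "real ^ 'n::finite"
  assumes \<Phi>: "schur_convex \<Phi>" "monotonically_even \<Phi>"
    and w: "w \<in> int_vectors"
    and le: "\<And>c. 0 \<le> c \<Longrightarrow> c \<in> \<int> \<Longrightarrow> hinge_sum c z \<le> hinge_sum c w"
  shows "\<Phi> z \<le> \<Phi> w"
proof -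
  define az aw :: "real ^ 'n" where "az = (\<chi> i. \<bar>z $ i\<bar>)" and "aw = (\<chi> i. \<bar>w $ i\<bar>)"
  let ?n = "CARD('n)"
  define X where "X k = (\<Sum>i<k. decreasing_rearrangement az ! i)" for k
  define Y where "Y k = (\<Sum>i<k. decreasing_rearrangement aw ! i)" for k
  obtain \<tau> :: "nat \<Rightarrow> 'n" where \<tau>: "bij_betw \<tau> {..<CARD('n)} UNIV"
    "\<And>i j. i \<le> j \<Longrightarrow> j < CARD('n) \<Longrightarrow> az $ \<tau> j \<le> az $ \<tau> i"
    "\<And>i. i < CARD('n) \<Longrightarrow> decreasing_rearrangement az ! i = az $ \<tau> i"
    using decreasing_rearrangement_enumeration[of az] by blast
  obtain \<rho> :: "nat \<Rightarrow> 'n" where \<rho>: "bij_betw \<rho> {..<CARD('n)} UNIV"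
    "\<And>i j. i \<le> j \<Longrightarrow> j < CARD('n) \<Longrightarrow> aw $ \<rho> j \<le> aw $ \<rho> i"
    "\<And>i. i < CARD('n) \<Longrightarrow> decreasing_rearrangement aw ! i = aw $ \<rho> i"
    using decreasing_rearrangement_enumeration[of aw] by blast
  have X_mono: "X k \<le> X ?n" if "k \<le> ?n" for k
    unfolding X_def by (rule sum_mono2) (use that \<tau>(3) in \<open>auto simp: az_def\<close>)
  have X_le_Y: "X k \<le> Y k" if k: "0 < k" "k \<le> ?n" for k
  proof -
    \<comment> \<open>The \<open>k\<close>-th largest absolute value of \<open>w\<close>: at this
      level the threshold bound is exact for \<open>aw\<close>, and it is a nonnegative integer, so
      the hypothesis on hinge sums applies.\<close>
    define c where "c = aw $ \<rho> (k - 1)"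
    have c: "0 \<le> c" "c \<in> \<int>" using w by (auto simp: c_def aw_def int_vectors_def)
    have "X k \<le> real k * c + (\<Sum>j\<in>UNIV. max (az $ j - c) 0)"
      unfolding X_def by (rule top_sum_le[OF k(2)])
    also have "\<dots> \<le> real k * c + (\<Sum>j\<in>UNIV. max (aw $ j - c) 0)"
      using le[OF c] by (simp add: hinge_sum_def az_def aw_def)
    also have "\<dots> = Y k"
      unfolding Y_def by (rule top_sum_eq[symmetric]) (use k \<rho>(2,3) in \<open>auto simp: c_def\<close>)
    finally show ?thesis .
  qed
  define U where "U k = min (Y k) (X ?n)" for k
  define u :: "real ^ 'n" where "u = (\<chi> j. let i = inv_into {..<?n} \<rho> j in U (Suc i) - U i)"
  have inj: "inj_on \<rho> {..<?n}" using \<rho> by (simp add: bij_betw_def)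
  have u: "u $ \<rho> i = U (Suc i) - U i" if "i < ?n" for i
    using inv_into_f_f[OF inj, of i] that by (simp add: u_def Let_def)
  have Y_Suc: "Y (Suc i) = Y i + aw $ \<rho> i" if "i < ?n" for i using \<rho>(3)[OF that] by (simp add: Y_def)
  have aw_nonneg: "0 \<le> aw $ j" and az_nonneg: "0 \<le> az $ j" for j by (simp_all add: aw_def az_def)
  \<comment> \<open>\<open>Y\<close> is concave, and its minimum with a constant is still concave,
    so the increments of \<open>U\<close> decrease.\<close>
  have "u $ \<rho> (Suc i) \<le> u $ \<rho> i" if "Suc i < ?n" for i
    using that u[of i] u[of "Suc i"] Y_Suc[of i] Y_Suc[of "Suc i"] \<rho>(2)[of i "Suc i"]
      aw_nonneg[of "\<rho> i"] aw_nonneg[of "\<rho> (Suc i)"] by (simp add: U_def min_def)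
  then have du: "decreasing_rearrangement u = map (\<lambda>i. u $ \<rho> i) [0..<?n]"
    by (intro decreasing_rearrangement_eq[OF \<rho>(1)])
  have U0: "U 0 = 0"
    using X_mono[of 0] by (simp add: U_def Y_def X_def)
  have top_u: "(\<Sum>i<k. decreasing_rearrangement u ! i) = U k" if "k \<le> ?n" for k
    using that u sum_lessThan_telescope[of U k] by (simp add: du U0)
  have vsum_eq: "vsum v UNIV = (\<Sum>i<?n. decreasing_rearrangement v ! i)" for v :: "real ^ 'n"
  proof -
    obtain \<sigma> :: "nat \<Rightarrow> 'n" where \<sigma>: "bij_betw \<sigma> {..<?n} UNIV"
      "\<And>i j. i \<le> j \<Longrightarrow> j < ?n \<Longrightarrow> v $ \<sigma> j \<le> v $ \<sigma> i"
      "\<And>i. i < ?n \<Longrightarrow> decreasing_rearrangement v ! i = v $ \<sigma> i"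
      using decreasing_rearrangement_enumeration[of v] by blast
    have "(\<Sum>i<?n. decreasing_rearrangement v ! i) = (\<Sum>i<?n. v $ \<sigma> i)" using \<sigma>(3) by simp
    also have "\<dots> = vsum v UNIV" unfolding vsum_def by (rule sum.reindex_bij_betw[OF \<sigma>(1)])
    finally show ?thesis ..
  qed
  have "majorized az u"
    unfolding majorized_def
  proof (intro conjI ballI)
    fix k assume "k \<in> {1..?n}"
    then show "(\<Sum>i<k. decreasing_rearrangement az ! i) \<le> (\<Sum>i<k. decreasing_rearrangement u ! i)"
      using X_mono[of k] X_le_Y[of k] by (simp add: top_u U_def X_def[symmetric])
  next
    show "vsum az UNIV = vsum u UNIV"
      \<comment> \<open>At the full length the truncation is active, so the totals agree.\<close>
      using X_le_Y[of ?n] by (simp add: vsum_eq top_u U_def X_def[symmetric])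
  qed
  then have "\<Phi> az \<le> \<Phi> u" using \<Phi>(1) by (simp add: schur_convex_def)
  moreover have "\<Phi> z \<le> \<Phi> az" by (rule monotonically_even_le[OF \<Phi>(2)]) (simp add: az_def)
  moreover have "\<Phi> u \<le> \<Phi> w"
  proof (rule monotonically_even_le[OF \<Phi>(2)])
    fix j
    obtain i where i: "i < ?n" "j = \<rho> i" using \<rho>(1) by (metis bij_betw_iff_bijections UNIV_I lessThan_iff)
    \<comment> \<open>Truncating the nondecreasing \<open>Y\<close> leaves increments between 0 and
      those of \<open>Y\<close>.\<close>
    show "\<bar>u $ j\<bar> \<le> \<bar>w $ j\<bar>"
      using u[OF i(1)] Y_Suc[OF i(1)] aw_nonneg[of "\<rho> i"] i(2) by (auto simp: U_def aw_def min_def)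
  qed
  ultimately show ?thesis by linarith
qed

section \<open>Even convex functions on the integers\<close>

lemma even_convex_hinge_decomposition:
  fixes \<phi> :: "real \<Rightarrow> real"
  assumes even: "\<And>t. \<phi> (- t) = \<phi> t" and conv: "convex_on UNIV \<phi>"
  obtains w :: "nat \<Rightarrow> real" where "\<And>c. 0 \<le> w c"
    "\<And>t M. t \<in> \<int> \<Longrightarrow> \<bar>t\<bar> \<le> real M \<Longrightarrow> \<phi> t = \<phi> 0 + (\<Sum>c<M. w c * max (\<bar>t\<bar> - real c) 0)"
proof -
  have mid: "2 * \<phi> t \<le> \<phi> (t + 1) + \<phi> (t - 1)" for t
    using convex_onD[OF conv, of "1/2" "t + 1" "t - 1"] by (simp add: field_simps)
  \<comment> \<open>Second differences of \<open>\<phi>\<close>, nonnegative by midpoint convexity.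
    At 0 evenness makes the second difference twice the slope, and the weight is half of it.\<close>
  define w where "w c = (if c = 0 then \<phi> 1 - \<phi> 0
      else \<phi> (real c + 1) - 2 * \<phi> (real c) + \<phi> (real c - 1))" for c
  have w_sum: "(\<Sum>c<Suc m. w c) = \<phi> (real m + 1) - \<phi> (real m)" for m
  proof (induction m)
    case (Suc m)
    have "(\<Sum>c<Suc (Suc m). w c) = (\<Sum>c<Suc m. w c) + w (Suc m)" by simp
    also have "w (Suc m) = \<phi> (real (Suc m) + 1) - 2 * \<phi> (real (Suc m)) + \<phi> (real m)"
      by (simp add: w_def)
    finally show ?case using Suc.IH by (simp add: add.commute)
  qed (simp add: w_def)
  have nat: "\<phi> (real m) = \<phi> 0 + (\<Sum>c<m. w c * (real m - real c))" for m
  proof (induction m)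
    case (Suc m)
    have "(\<Sum>c<Suc m. w c * (real (Suc m) - real c)) = (\<Sum>c<Suc m. w c * (real m - real c) + w c)"
      by (intro sum.cong) (auto simp: algebra_simps)
    also have "\<dots> = (\<Sum>c<m. w c * (real m - real c)) + (\<phi> (real m + 1) - \<phi> (real m))"
      by (subst w_sum[symmetric]) (simp only: sum.distrib sum.lessThan_Suc, simp)
    finally show ?case using Suc.IH by (simp add: add.commute)
  qed simp
  show thesis
  proof (rule that)
    show "0 \<le> w c" for c
      using mid[of 0] mid[of "real c"] even[of 1] by (simp add: w_def)
    fix t :: real and M assume t: "t \<in> \<int>" "\<bar>t\<bar> \<le> real M"
    obtain k :: int where k: "t = of_int k" using t(1) by (elim Ints_cases)
    define m where "m = nat \<bar>k\<bar>"
    have m: "\<bar>t\<bar> = real m" by (simp add: k m_def)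
    have "\<phi> t = \<phi> (real m)" using even[of t] by (cases "0 \<le> t") (simp_all add: m[symmetric])
    also have "\<dots> = \<phi> 0 + (\<Sum>c<m. w c * max (real m - real c) 0)"
      by (subst nat) simp
    also have "(\<Sum>c<m. w c * max (real m - real c) 0) = (\<Sum>c<M. w c * max (real m - real c) 0)"
      by (rule sum.mono_neutral_left) (use t(2) m in auto)
    finally show "\<phi> t = \<phi> 0 + (\<Sum>c<M. w c * max (\<bar>t\<bar> - real c) 0)" by (simp add: m)
  qed
qed

lemma even_convex_sum_le_of_hinge_sums:
  fixes z w :: "real ^ 'n::finite"
  assumes \<phi>: "\<And>t. \<phi> (- t) = \<phi> t" "convex_on UNIV \<phi>"
    and zw: "z \<in> int_vectors" "w \<in> int_vectors"
    and le: "\<And>c. 0 \<le> c \<Longrightarrow> c \<in> \<int> \<Longrightarrow> hinge_sum c z \<le> hinge_sum c w"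
  shows "(\<Sum>i\<in>UNIV. \<phi> (z $ i)) \<le> (\<Sum>i\<in>UNIV. \<phi> (w $ i))"
proof -
  obtain a :: "nat \<Rightarrow> real" where a: "\<And>c. 0 \<le> a c"
    "\<And>t M. t \<in> \<int> \<Longrightarrow> \<bar>t\<bar> \<le> real M \<Longrightarrow> \<phi> t = \<phi> 0 + (\<Sum>c<M. a c * max (\<bar>t\<bar> - real c) 0)"
    using even_convex_hinge_decomposition[OF \<phi>] by blast
  \<comment> \<open>A common cutoff, so that both vectors are expanded in the same hinges.\<close>
  obtain M where M: "norm z + norm w \<le> real M" using real_arch_simple by blast
  have eq: "(\<Sum>i\<in>UNIV. \<phi> (v $ i)) = real CARD('n) * \<phi> 0 + (\<Sum>c<M. a c * hinge_sum (real c) v)"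
    if "v \<in> int_vectors" "norm v \<le> real M" for v :: "real ^ 'n"
  proof -
    have "\<phi> (v $ i) = \<phi> 0 + (\<Sum>c<M. a c * max (\<bar>v $ i\<bar> - real c) 0)" for i
      using that component_le_norm_cart[of v i] by (intro a(2)) (auto simp: int_vectors_def)
    then have "(\<Sum>i\<in>UNIV. \<phi> (v $ i))
        = real CARD('n) * \<phi> 0 + (\<Sum>i\<in>UNIV. \<Sum>c<M. a c * max (\<bar>v $ i\<bar> - real c) 0)"
      by (simp add: sum.distrib)
    also have "(\<Sum>i\<in>UNIV. \<Sum>c<M. a c * max (\<bar>v $ i\<bar> - real c) 0) = (\<Sum>c<M. a c * hinge_sum (real c) v)"
      unfolding hinge_sum_def by (subst sum.swap) (simp add: sum_distrib_left)
    finally show ?thesis .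
  qed
  have "norm z \<le> real M" "norm w \<le> real M" using M norm_ge_zero[of z] norm_ge_zero[of w] by linarith+
  then show ?thesis
    using zw a(1) le by (simp add: eq sum_mono mult_left_mono)
qed

text \<open>The shift \<open>b\<close> is so spread out that every \<open>x + b\<close> with \<open>x \<in> C\<close> has the signs \<open>- s\<close> and
  absolute values decreasing along \<open>\<rho>\<close>; the hinges then cut off exactly the prefixes.\<close>

lemma prefix_optimal_of_hinge_sums:
  fixes C :: "(real ^ 'n::finite) set"
  assumes bdd: "bounded C"
    and opt: "\<And>b. b \<in> int_vectors \<Longrightarrow>
      \<exists>x'\<in>C. \<forall>c\<ge>0. \<forall>x\<in>C. hinge_sum c (x' + b) \<le> hinge_sum c (x + b)"
  shows "prefix_optimal C"
  unfolding prefix_optimal_def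
proof (intro allI impI, elim conjE)
  fix \<rho> :: "nat \<Rightarrow> 'n" and s :: "real ^ 'n"
  let ?n = "CARD('n)"
  assume \<rho>: "bij_betw \<rho> {..<?n} UNIV" and s: "\<forall>i. s $ i \<in> {- 1, 1}"
  obtain B where B: "\<And>x. x \<in> C \<Longrightarrow> norm x \<le> B" using bdd by (auto simp: bounded_iff)
  obtain R :: nat where "B \<le> real R" using real_arch_simple by blast
  then have R: "\<bar>x $ i\<bar> \<le> real R" if "x \<in> C" for x i
    using B[OF that] component_le_norm_cart[of x i] by linarith
  \<comment> \<open>Consecutive magnitudes differ by \<open>2 * R\<close> and the smallest is
    \<open>2 * R\<close>, so perturbations of size \<open>R\<close> change neither signs nor
    order.\<close>
  define M where "M i = real (2 * (?n - i) * R)" for i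
  define b :: "real ^ 'n" where "b = (\<chi> j. - (s $ j * M (inv_into {..<?n} \<rho> j)))"
  have inj: "inj_on \<rho> {..<?n}" using \<rho> by (simp add: bij_betw_def)
  have b: "b $ \<rho> i = - (s $ \<rho> i * M i)" if "i < ?n" for i
    using inv_into_f_f[OF inj, of i] that by (simp add: b_def)
  have "b $ j \<in> \<int>" for j
  proof -
    have "s $ j \<in> \<int>" using s[rule_format, of j] by auto
    then show ?thesis by (simp add: b_def M_def)
  qed
  then obtain x' where x': "x' \<in> C"
    "\<And>c x. 0 \<le> c \<Longrightarrow> x \<in> C \<Longrightarrow> hinge_sum c (x' + b) \<le> hinge_sum c (x + b)"
    using opt[of b] by (auto simp: int_vectors_def)
  \<comment> \<open>The threshold lies midway between \<open>M k\<close> and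
    \<open>M (k - 1)\<close>: exactly the first \<open>k\<close> entries contribute, and minimising
    the hinge sum maximises the signed prefix sum.\<close>
  have hinge: "hinge_sum (real ((2 * (?n - k) + 1) * R)) (x + b)
      = (\<Sum>i<k. M i - real ((2 * (?n - k) + 1) * R)) - (\<Sum>i<k. s $ \<rho> i * x $ \<rho> i)"
    if x: "x \<in> C" and k: "k \<le> ?n" for x k
  proof -
    let ?c = "real ((2 * (?n - k) + 1) * R)"
    have abs: "\<bar>(x + b) $ \<rho> i\<bar> = M i - s $ \<rho> i * x $ \<rho> i" and sx: "\<bar>s $ \<rho> i * x $ \<rho> i\<bar> \<le> real R"
      if i: "i < ?n" for i
    proof -
      have si: "s $ \<rho> i = - 1 \<or> s $ \<rho> i = 1" using s[rule_format, of "\<rho> i"] by auto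
      then show *: "\<bar>s $ \<rho> i * x $ \<rho> i\<bar> \<le> real R" using R[OF x, of "\<rho> i"] by (elim disjE) simp_all
      have "1 * R \<le> 2 * (?n - i) * R" by (rule mult_le_mono1) (use i in linarith)
      then have "real R \<le> M i" unfolding M_def of_nat_le_iff by (simp only: mult_1)
      then show "\<bar>(x + b) $ \<rho> i\<bar> = M i - s $ \<rho> i * x $ \<rho> i"
        using * si b[OF i] by (elim disjE) simp_all
    qed
    have "hinge_sum ?c (x + b) = (\<Sum>i<?n. max (M i - s $ \<rho> i * x $ \<rho> i - ?c) 0)"
      unfolding hinge_sum_def using abs
      by (simp add: sum.reindex_bij_betw[OF \<rho>, symmetric] del: vector_add_component)
    also have "\<dots> = (\<Sum>i<k. max (M i - s $ \<rho> i * x $ \<rho> i - ?c) 0)"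
    proof (rule sum.mono_neutral_right)
      show "\<forall>i\<in>{..<?n} - {..<k}. max (M i - s $ \<rho> i * x $ \<rho> i - ?c) 0 = 0"
      proof
        fix i assume i: "i \<in> {..<?n} - {..<k}"
        then have "(2 * (?n - i) + 1) * R \<le> (2 * (?n - k) + 1) * R" by (intro mult_le_mono1) auto
        then have "M i + real R \<le> ?c" unfolding M_def of_nat_add[symmetric] of_nat_le_iff by (simp add: algebra_simps)
        then show "max (M i - s $ \<rho> i * x $ \<rho> i - ?c) 0 = 0" using sx[of i] i by auto
      qed
    qed (use k in auto)
    also have "\<dots> = (\<Sum>i<k. M i - ?c - s $ \<rho> i * x $ \<rho> i)"
    proof (rule sum.cong)
      fix i assume i: "i \<in> {..<k}"
      then have "(2 * (?n - k) + 1 + 1) * R \<le> 2 * (?n - i) * R" using k by (intro mult_le_mono1) auto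
      then have "?c + real R \<le> M i" unfolding M_def of_nat_add[symmetric] of_nat_le_iff by (simp add: algebra_simps)
      then show "max (M i - s $ \<rho> i * x $ \<rho> i - ?c) 0 = M i - ?c - s $ \<rho> i * x $ \<rho> i"
        using sx[of i] i k by auto
    qed simp
    finally show ?thesis by (simp only: sum_subtractf)
  qed
  show "\<exists>x'\<in>C. \<forall>x\<in>C. \<forall>k\<le>?n. (\<Sum>i<k. s $ \<rho> i * x $ \<rho> i) \<le> (\<Sum>i<k. s $ \<rho> i * x' $ \<rho> i)"
  proof (intro bexI[of _ x'] ballI allI impI)
    fix x k assume "x \<in> C" "k \<le> ?n"
    then show "(\<Sum>i<k. s $ \<rho> i * x $ \<rho> i) \<le> (\<Sum>i<k. s $ \<rho> i * x' $ \<rho> i)"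
      using x'(2)[of "real ((2 * (?n - k) + 1) * R)" x] hinge[of x k] hinge[OF x'(1), of k]
      by (simp del: of_nat_mult of_nat_add)
  qed (rule x'(1))
qed

section \<open>Reindexing and assembly of the equivalences\<close>

lemma prefix_optimal_iff:
  fixes C :: "(real ^ 'n::finite) set"
  shows "prefix_optimal C \<longleftrightarrow> (\<forall>(\<pi> :: nat \<Rightarrow> 'n) (s :: real ^ 'n).
         bij_betw \<pi> {1..CARD('n)} UNIV \<and> (\<forall>i. s $ i \<in> {- 1, 1}) \<longrightarrow>
         (\<exists>x'\<in>C. \<forall>x\<in>C. \<forall>k\<in>{1..CARD('n)}.
            (\<Sum>i = 1..k. s $ \<pi> i * x' $ \<pi> i) \<ge> (\<Sum>i = 1..k. s $ \<pi> i * x $ \<pi> i)))" (is "_ \<longleftrightarrow> ?R")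
proof
  have shift: "bij_betw Suc {..<CARD('n)} {1..CARD('n)}"
    by (rule bij_betwI[where g = "\<lambda>i. i - 1"]) auto
  have unshift: "bij_betw (\<lambda>i. i - 1) {1..CARD('n)} {..<CARD('n)}"
    by (rule bij_betwI[where g = Suc]) auto
  show ?R if L: "prefix_optimal C"
  proof (intro allI impI, elim conjE)
    fix \<pi> :: "nat \<Rightarrow> 'n" and s :: "real ^ 'n"
    assume "bij_betw \<pi> {1..CARD('n)} UNIV" and s: "\<forall>i. s $ i \<in> {- 1, 1}"
    then have "bij_betw (\<pi> \<circ> Suc) {..<CARD('n)} UNIV" using bij_betw_trans[OF shift] by blast
    then obtain x' where "x' \<in> C" "\<forall>x\<in>C. \<forall>k\<le>CARD('n).
        (\<Sum>i<k. s $ \<pi> (Suc i) * x $ \<pi> (Suc i)) \<le> (\<Sum>i<k. s $ \<pi> (Suc i) * x' $ \<pi> (Suc i))"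
      using L s unfolding prefix_optimal_def comp_def by blast
    then show "\<exists>x'\<in>C. \<forall>x\<in>C. \<forall>k\<in>{1..CARD('n)}.
        (\<Sum>i = 1..k. s $ \<pi> i * x' $ \<pi> i) \<ge> (\<Sum>i = 1..k. s $ \<pi> i * x $ \<pi> i)"
      by (intro bexI[of _ x']) (auto simp: sum.atLeast1_atMost_eq)
  qed
  show "prefix_optimal C" if R: ?R
    unfolding prefix_optimal_def
  proof (intro allI impI, elim conjE)
    fix \<rho> :: "nat \<Rightarrow> 'n" and s :: "real ^ 'n"
    assume "bij_betw \<rho> {..<CARD('n)} UNIV" and s: "\<forall>i. s $ i \<in> {- 1, 1}"
    then have "bij_betw (\<rho> \<circ> (\<lambda>i. i - 1)) {1..CARD('n)} UNIV" using bij_betw_trans[OF unshift] by blast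
    then obtain x' where x': "x' \<in> C" "\<forall>x\<in>C. \<forall>k\<in>{1..CARD('n)}.
        (\<Sum>i=1..k. s $ \<rho> (i - 1) * x $ \<rho> (i - 1)) \<le> (\<Sum>i=1..k. s $ \<rho> (i - 1) * x' $ \<rho> (i - 1))"
      using R[rule_format, of "\<rho> \<circ> (\<lambda>i. i - 1)" s] s unfolding comp_def by blast
    have "(\<Sum>i<k. s $ \<rho> i * x $ \<rho> i) \<le> (\<Sum>i<k. s $ \<rho> i * x' $ \<rho> i)" if "x \<in> C" "k \<le> CARD('n)" for x k
      using x'(2)[rule_format, of x k] that by (cases "k = 0") (auto simp: sum.atLeast1_atMost_eq)
    then show "\<exists>x'\<in>C. \<forall>x\<in>C. \<forall>k\<le>CARD('n).
        (\<Sum>i<k. s $ \<rho> i * x $ \<rho> i) \<le> (\<Sum>i<k. s $ \<rho> i * x' $ \<rho> i)"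
      using x'(1) by blast
  qed
qed

text \<open>A point nearest to \<open>- b\<close> exists because \<open>C\<close> is finite and
  nonempty; since \<open>C\<close> is the polyhedron of its own support function, this one point
  minimises the hinge sums at all levels.\<close>

lemma ex_hinge_minimal:
  fixes C :: "(real ^ 'n::finite) set"
  assumes int: "C \<subseteq> int_vectors" and fin: "finite C" and hf: "hole_free C"
    and opt: "prefix_optimal C" and b: "b \<in> int_vectors"
  obtains x where "x \<in> C"
    "\<And>c y. 0 \<le> c \<Longrightarrow> c \<in> \<int> \<Longrightarrow> y \<in> C \<Longrightarrow> hinge_sum c (x + b) \<le> hinge_sum c (y + b)"
proof -
  define H where "H = sign_fun (support_fun C)"
  note H = bisubmodular_of_prefix_optimal[OF int fin hf opt, folded H_def]
  have "C \<noteq> {}" using prefix_optimal_comonotone[OF opt, of 0] by blast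
  then have "Min ((\<lambda>y. (y + b) \<bullet> (y + b)) ` C) \<in> (\<lambda>y. (y + b) \<bullet> (y + b)) ` C"
    using fin by (intro Min_in) auto
  then obtain x where x: "x \<in> C" "(x + b) \<bullet> (x + b) = Min ((\<lambda>y. (y + b) \<bullet> (y + b)) ` C)"
    by auto
  have min: "(x + b) \<bullet> (x + b) \<le> (y + b) \<bullet> (y + b)" if "y \<in> C" for y
    unfolding x(2) by (rule Min_le) (use fin that in auto)
  show thesis
  proof (rule that[OF x(1)])
    fix c :: real and y assume "0 \<le> c" "c \<in> \<int>" "y \<in> C"
    then show "hinge_sum c (x + b) \<le> hinge_sum c (y + b)"
      using hinge_sum_minimal[OF H(2) _ _ b, folded H(3), of x c y] H(1) x(1) min by simp
  qed
qed

theorem theorem8: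
  fixes C :: "(real ^ 'n) set"
  assumes integral: "C \<subseteq> int_vectors"
    and bdd: "bounded C"
    and hole_free: "hole_free C"
  shows
    "((\<forall>b\<in>int_vectors. \<exists>x. least_weakly_abs_majorized b C x)
       \<longleftrightarrow>
      (\<forall>b\<in>int_vectors. \<exists>x'\<in>C. \<forall>\<Phi> :: real ^ 'n \<Rightarrow> real.
         schur_convex \<Phi> \<and> monotonically_even \<Phi> \<and> continuous_on UNIV \<Phi> \<longrightarrow>
         (\<forall>x\<in>C. \<Phi> (x' + b) \<le> \<Phi> (x + b))))
     \<and>
     ((\<forall>b\<in>int_vectors. \<exists>x'\<in>C. \<forall>\<Phi> :: real ^ 'n \<Rightarrow> real.
         schur_convex \<Phi> \<and> monotonically_even \<Phi> \<and> continuous_on UNIV \<Phi> \<longrightarrow>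
         (\<forall>x\<in>C. \<Phi> (x' + b) \<le> \<Phi> (x + b)))
       \<longleftrightarrow>
      (\<forall>(\<pi> :: nat \<Rightarrow> 'n) (s :: real ^ 'n).
         bij_betw \<pi> {1..CARD('n)} UNIV \<and> (\<forall>i. s $ i \<in> {- 1, 1}) \<longrightarrow>
         (\<exists>x'\<in>C. \<forall>x\<in>C. \<forall>k\<in>{1..CARD('n)}.
            (\<Sum>i = 1..k. s $ \<pi> i * x' $ \<pi> i) \<ge> (\<Sum>i = 1..k. s $ \<pi> i * x $ \<pi> i))))
     \<and>
     ((\<forall>(\<pi> :: nat \<Rightarrow> 'n) (s :: real ^ 'n).
         bij_betw \<pi> {1..CARD('n)} UNIV \<and> (\<forall>i. s $ i \<in> {- 1, 1}) \<longrightarrow>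
         (\<exists>x'\<in>C. \<forall>x\<in>C. \<forall>k\<in>{1..CARD('n)}.
            (\<Sum>i = 1..k. s $ \<pi> i * x' $ \<pi> i) \<ge> (\<Sum>i = 1..k. s $ \<pi> i * x $ \<pi> i)))
       \<longleftrightarrow>
      (integral_on_pairs (support_fun C) \<and> bisubmodular (support_fun C) \<and>
       C = int_bisubmodular_polyhedron (support_fun C)))"
  (is "(?S1 \<longleftrightarrow> ?S2) \<and> (?S2 \<longleftrightarrow> ?S3) \<and> (?S3 \<longleftrightarrow> ?S4)")
proof -
  \<comment> \<open>Each of the four conditions is shown equivalent to
    \<open>prefix_optimal C\<close>.\<close>
  have fin: "finite C" by (rule finite_bounded_int_vectors[OF integral bdd])
  have "prefix_optimal C" if S1: ?S1
  proof (rule prefix_optimal_of_hinge_sums[OF bdd])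
    fix b :: "real ^ 'n" assume "b \<in> int_vectors"
    then obtain x' where x': "x' \<in> C" "\<forall>y\<in>C. weakly_abs_majorized b x' y"
      using S1 by (auto simp: least_weakly_abs_majorized_def)
    have "hinge_sum c (x' + b) \<le> hinge_sum c (y + b)" if "y \<in> C" for c y
    proof -
      have "(\<forall>t. max (\<bar>- t\<bar> - c) 0 = max (\<bar>t\<bar> - c) 0) \<and>
          continuous_on UNIV (\<lambda>t::real. max (\<bar>t\<bar> - c) 0) \<and> convex_on UNIV (\<lambda>t. max (\<bar>t\<bar> - c) 0)"
        by (intro conjI convex_on_hinge continuous_intros) simp
      then show ?thesis
        using bspec[OF x'(2) that, unfolded weakly_abs_majorized_def, rule_format, of "\<lambda>t. max (\<bar>t\<bar> - c) 0"]
        by (simp add: hinge_sum_def)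
    qed
    then show "\<exists>x'\<in>C. \<forall>c\<ge>0. \<forall>x\<in>C. hinge_sum c (x' + b) \<le> hinge_sum c (x + b)" using x'(1) by blast
  qed
  moreover have "prefix_optimal C" if S2: ?S2
  proof (rule prefix_optimal_of_hinge_sums[OF bdd])
    fix b :: "real ^ 'n" assume "b \<in> int_vectors"
    then show "\<exists>x'\<in>C. \<forall>c\<ge>0. \<forall>x\<in>C. hinge_sum c (x' + b) \<le> hinge_sum c (x + b)"
      using S2 hinge_sum_schur_convex hinge_sum_monotonically_even hinge_sum_continuous by metis
  qed
  moreover have ?S1 if opt: "prefix_optimal C"
  proof
    fix b :: "real ^ 'n" assume b: "b \<in> int_vectors"
    obtain x where x: "x \<in> C"
      "\<And>c y. 0 \<le> c \<Longrightarrow> c \<in> \<int> \<Longrightarrow> y \<in> C \<Longrightarrow> hinge_sum c (x + b) \<le> hinge_sum c (y + b)"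
      using ex_hinge_minimal[OF integral fin hole_free opt b] by blast
    have int: "y + b \<in> int_vectors" if "y \<in> C" for y
      using that integral b by (auto simp: int_vectors_def)
    have "least_weakly_abs_majorized b C x"
      unfolding least_weakly_abs_majorized_def weakly_abs_majorized_def
    proof (intro conjI ballI allI impI)
      fix y and \<phi> :: "real \<Rightarrow> real"
      assume y: "y \<in> C" and \<phi>: "(\<forall>t. \<phi> (- t) = \<phi> t) \<and> continuous_on UNIV \<phi> \<and> convex_on UNIV \<phi>"
      show "(\<Sum>i\<in>UNIV. \<phi> (x $ i + b $ i)) \<le> (\<Sum>i\<in>UNIV. \<phi> (y $ i + b $ i))"
        using even_convex_sum_le_of_hinge_sums[of \<phi> "x + b" "y + b"] \<phi> x y int by simp
    qed (rule x(1))
    then show "\<exists>x. least_weakly_abs_majorized b C x" ..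
  qed
  moreover have ?S2 if opt: "prefix_optimal C"
  proof
    fix b :: "real ^ 'n" assume b: "b \<in> int_vectors"
    obtain x where x: "x \<in> C"
      "\<And>c y. 0 \<le> c \<Longrightarrow> c \<in> \<int> \<Longrightarrow> y \<in> C \<Longrightarrow> hinge_sum c (x + b) \<le> hinge_sum c (y + b)"
      using ex_hinge_minimal[OF integral fin hole_free opt b] by blast
    have int: "y + b \<in> int_vectors" if "y \<in> C" for y
      using that integral b by (auto simp: int_vectors_def)
    show "\<exists>x'\<in>C. \<forall>\<Phi> :: real ^ 'n \<Rightarrow> real.
         schur_convex \<Phi> \<and> monotonically_even \<Phi> \<and> continuous_on UNIV \<Phi> \<longrightarrow>
         (\<forall>x\<in>C. \<Phi> (x' + b) \<le> \<Phi> (x + b))"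
      using schur_convex_le_of_hinge_sums int x by (intro bexI[of _ x]) blast+
  qed
  moreover have "?S3 \<longleftrightarrow> prefix_optimal C" by (rule prefix_optimal_iff[symmetric])
  moreover have "prefix_optimal C \<longleftrightarrow> ?S4"
    unfolding integral_on_pairs_iff bisubmodular_iff int_bisubmodular_polyhedron_eq
    using bisubmodular_of_prefix_optimal[OF integral fin hole_free]
      prefix_optimal_of_bisubmodular[of "sign_fun (support_fun C)"] by metis
  ultimately show ?thesis by blast
qed

end
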